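(* For each $n\ge1$ let $(X_{j,n})_{j\ge1}$ be a sequence of centered real-valued random variables such that $\|X_{j,n}\|_\infty\le M_n$ for every $j\ge1$, where $M_n$ is a positive number. For $k\ge0$ let $$\alpha_n(k)=\sup_{j\ge1}\alpha\big(\sigma(X_{i,n},i\le j),\sigma(X_{i,n},i\ge k+j)\big),$$ and assume that, for some $c>0$, $\alpha(k)=\sup_{n\ge1}\alpha_n(k)$ satisfies $\alpha(k)\le\exp(-2ck)$ for all $k\ge1$. Define $$v^2=\sup_{n\ge1}\sup_{i>0}\Big(\mathrm{Var}(X_{i,n})+2\sum_{j>i}|\mathrm{Cov}(X_{i,n},X_{j,n})|\Big)$$ and suppose $v^2<\infty$. Let $S_n=\sum_{i=1}^nX_{i,n}$, $\sigma_n^2=\mathrm{Var}(S_n)$, and assume that $\liminf_{n\to\infty}\sigma_n^2/n>0$. Then for every sequence of positive reals $(a_n)$ with $$a_n\to0\quad\text{and}\quad\frac{na_n}{M_n^2(\log n)^4}\to\infty,$$ the sequence $(\sigma_n^{-1}S_n)_{n\ge1}$ satisfies the moderate deviations principle with speed $a_n$ and good rate function $I(t)=t^2/2$.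
   Context: For $\sigma$-algebras $\mathcal{A},\mathcal{B}$, $\alpha(\mathcal{A},\mathcal{B})=\sup_{A\in\mathcal{A},B\in\mathcal{B}}|\mathbb{P}(A\cap B)-\mathbb{P}(A)\mathbb{P}(B)|$. $\|Y\|_\infty$ denotes the essential supremum norm of $Y$. A sequence $(T_n)$ of real random variables satisfies the moderate deviations principle with speed $a_n\to0$ and rate function $I$ if for each Borel set $A\subset\mathbb{R}$, $$-\inf_{t\in A^o}I(t)\le\liminf_n a_n\log\mathbb{P}(\sqrt{a_n}\,T_n\in A)\le\limsup_n a_n\log\mathbb{P}(\sqrt{a_n}\,T_n\in A)\le-\inf_{t\in\bar A}I(t),$$ where $\bar A$ and $A^o$ denote the closure and interior of $A$. (Here $\sigma_n>0$ for all large $n$, so $\sigma_n^{-1}S_n$ is defined for large $n$.) *)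

theory Defs
  imports "HOL-Probability.Probability"
begin

definition strong_mixing_coeff :: "'a measure \<Rightarrow> 'a set set \<Rightarrow> 'a set set \<Rightarrow> real" where
  "strong_mixing_coeff P \<A> \<B> =
     (SUP (A, B) \<in> \<A> \<times> \<B>. \<bar>measure P (A \<inter> B) - measure P A * measure P B\<bar>)"

definition gen_sigma :: "'a measure \<Rightarrow> (nat \<Rightarrow> 'a \<Rightarrow> real) \<Rightarrow> nat set \<Rightarrow> 'a set set" where
  "gen_sigma P Y I =
     sigma_sets (space P) (\<Union>i\<in>I. {Y i -` B \<inter> space P | B. B \<in> sets borel})"

text \<open>Sequences are indexed from 1; index 0 is ignored. An array entry \<open>X\<^sub>j\<^sub>,\<^sub>n\<close> is written
  \<open>X j n\<close>. The real-valued suprema below are over nonempty sets bounded by 1 when \<open>P\<close> is a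
  probability measure.\<close>

definition mixing_seq :: "'a measure \<Rightarrow> (nat \<Rightarrow> 'a \<Rightarrow> real) \<Rightarrow> nat \<Rightarrow> real" where
  "mixing_seq P Y k =
     (SUP j \<in> {1..}. strong_mixing_coeff P (gen_sigma P Y {1..j}) (gen_sigma P Y {k + j..}))"

definition mixing_array :: "'a measure \<Rightarrow> (nat \<Rightarrow> nat \<Rightarrow> 'a \<Rightarrow> real) \<Rightarrow> nat \<Rightarrow> real" where
  "mixing_array P X k = (SUP n \<in> {1..}. mixing_seq P (\<lambda>j. X j n) k)"

definition covariance :: "'a measure \<Rightarrow> ('a \<Rightarrow> real) \<Rightarrow> ('a \<Rightarrow> real) \<Rightarrow> real" where
  "covariance P Y Z =
     integral\<^sup>L P (\<lambda>\<omega>. (Y \<omega> - integral\<^sup>L P Y) * (Z \<omega> - integral\<^sup>L P Z))"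

text \<open>The quantity \<open>v\<^sup>2\<close>, taken in the extended nonnegative reals so that its finiteness is
  meaningful; the sum over \<open>j > i\<close> is reindexed by \<open>j = i + 1 + m\<close>.\<close>

definition cov_bound :: "'a measure \<Rightarrow> (nat \<Rightarrow> nat \<Rightarrow> 'a \<Rightarrow> real) \<Rightarrow> ennreal" where
  "cov_bound P X =
     (SUP n \<in> {1..}. SUP i \<in> {1..}.
        ennreal (prob_space.variance P (X i n)) +
        2 * (\<Sum>m. ennreal \<bar>covariance P (X i n) (X (i + 1 + m) n)\<bar>))"

definition partial_sum :: "(nat \<Rightarrow> nat \<Rightarrow> 'a \<Rightarrow> real) \<Rightarrow> nat \<Rightarrow> 'a \<Rightarrow> real" where
  "partial_sum X n \<omega> = (\<Sum>i = 1..n. X i n \<omega>)"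

text \<open>Logarithm with the convention \<open>log 0 = -\<infinity>\<close> (the library's \<open>ln 0\<close> is \<open>0\<close>).\<close>

definition log_prob :: "real \<Rightarrow> ereal" where
  "log_prob p = (if p = 0 then -\<infinity> else ereal (ln p))"

definition good_rate_function :: "(real \<Rightarrow> ereal) \<Rightarrow> bool" where
  "good_rate_function I \<longleftrightarrow> (\<forall>t. 0 \<le> I t) \<and> (\<forall>r::real. compact {t. I t \<le> ereal r})"

text \<open>Infima are taken in the extended reals, hence are \<open>\<infinity>\<close> over the empty set.\<close>

definition moderate_deviations ::
    "'a measure \<Rightarrow> (nat \<Rightarrow> 'a \<Rightarrow> real) \<Rightarrow> (nat \<Rightarrow> real) \<Rightarrow> (real \<Rightarrow> ereal) \<Rightarrow> bool" where
  "moderate_deviations P T a I \<longleftrightarrow>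
     a \<longlonglongrightarrow> 0 \<and>
     (\<forall>A \<in> sets borel.
        - (INF t \<in> interior A. I t)
          \<le> liminf (\<lambda>n. ereal (a n) *
                log_prob (measure P {\<omega> \<in> space P. sqrt (a n) * T n \<omega> \<in> A})) \<and>
        limsup (\<lambda>n. ereal (a n) *
                log_prob (measure P {\<omega> \<in> space P. sqrt (a n) * T n \<omega> \<in> A}))
          \<le> - (INF t \<in> closure A. I t))"

end

theory Submission
  imports Defs
begin

text \<open>The heart of the matter is the asymptotics \<open>a\<^sub>n log E exp (\<lambda> S\<^sub>n / (\<sigma>\<^sub>n \<surd>a\<^sub>n)) \<rightarrow> \<lambda>\<^sup>2 / 2\<close>,
  from which the principle follows by the Gaertner--Ellis argument. With \<open>t\<close> of order
  \<open>(n a\<^sub>n)\<^sup>-\<^sup>1\<^sup>/\<^sup>2\<close>, the growth condition says \<open>t M\<^sub>n log\<^sup>2 n \<rightarrow> 0\<close>. Remove from \<open>{1..n}\<close>, Cantor-style,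
  a gap in the middle, then in the middle of each half, and so on, each gap being long enough for
  \<open>exp (- 2 c \<sqdot> gap)\<close> to beat the sup norm of the exponent on the adjacent halves. Along this tree
  the Laplace transform of the sum over what is left factorises up to a negligible error, and on the
  final blocks \<open>t M\<^sub>n |block|\<close> is small, so a second order expansion applies. The removed
  indices have proportion of order \<open>t M\<^sub>n log n\<close>. Their contribution is controlled by a Bernstein
  bound valid for arbitrary subsets of indices (deleting indices only increases the
  separation), which is itself proved by iterating the elimination, half of the remaining indices
  being used up at each step. Convexity of the log-Laplace transform then recombines the two parts.\<close>

section \<open>Gaussian limits of log-Laplace transforms\<close>

text \<open>Mixing controls covariances of bounded variables, while
  \<open>exp (t * S F \<omega>)\<close> is bounded only by the exponential of
  \<open>\<bar>t\<bar> * B * card F\<close>. A gap must therefore grow linearly with the sets on its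
  two sides, and cutting off short blocks one after another would set each of them against an
  exponent on the whole rest. In a balanced tree the gaps of one level have total length of order
  \<open>t * B * n\<close>, apart from a term \<open>\<Lambda> = ln n\<close> per gap, so all levels
  together cost one factor \<open>ln n\<close>. The Bernstein bound repeats the elimination of order
  \<open>ln n\<close> times. The reciprocals of the admissible ranges of \<open>t\<close> add up, to
  order \<open>B * (ln n)^2\<close>; since \<open>t^2\<close> is of order
  \<open>1 / (n * a n)\<close>, this is the origin of the fourth power of the logarithm. The term
  \<open>3 * \<Lambda>\<close> in every gap makes a cut cost \<open>n^-3\<close>, which pays for
  order \<open>n\<close> cuts and for the factor \<open>n^2\<close> in the comparison of second
  moments. The two parts are recombined at a fixed ratio \<open>\<theta>\<close>, which costs
  factors that tend to 1 as \<open>\<theta>\<close> tends to 0. Numerical constants are not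
  optimised.\<close>

lemma (in prob_space) chernoff_two_sided:
  fixes W :: "'a \<Rightarrow> real"
  assumes W: "W \<in> borel_measurable M" and a: "a > 0" and x: "x \<ge> 0"
    and i: "\<And>s. integrable M (\<lambda>\<omega>. exp (s * W \<omega> / a))"
    and A: "\<And>t. t \<in> A \<Longrightarrow> x \<le> \<bar>t\<bar>" "A \<in> sets borel"
  shows "prob {\<omega>\<in>space M. W \<omega> \<in> A} \<le>
    exp (- (x\<^sup>2 / a)) * (expectation (\<lambda>\<omega>. exp (x * W \<omega> / a)) + expectation (\<lambda>\<omega>. exp (- x * W \<omega> / a)))"
proof -
  let ?B = "{\<omega>\<in>space M. W \<omega> \<in> A}"
  have Bm: "?B \<in> sets M" using W A(2) by measurable
  have "prob ?B = expectation (indicator ?B)" using Bm by simp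
  also have "\<dots> \<le> expectation (\<lambda>\<omega>. exp (- (x\<^sup>2 / a)) * (exp (x * W \<omega> / a) + exp (- x * W \<omega> / a)))"
  proof (rule integral_mono)
    show "integrable M (indicator ?B :: 'a \<Rightarrow> real)"
      by (rule integrable_const_bound[where B=1]) (use Bm in auto)
    show "integrable M (\<lambda>\<omega>. exp (- (x\<^sup>2 / a)) * (exp (x * W \<omega> / a) + exp (- x * W \<omega> / a)))"
      using i[of x] i[of "-x"] by auto
    fix \<omega> assume "\<omega> \<in> space M"
    show "indicator ?B \<omega> \<le> exp (- (x\<^sup>2 / a)) * (exp (x * W \<omega> / a) + exp (- x * W \<omega> / a))"
    proof (cases "W \<omega> \<in> A")
      case True
      \<comment> \<open>Only \<open>\<bar>t\<bar> \<ge> x\<close> is known on \<open>A\<close>;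
        according to the sign of \<open>W \<omega>\<close>, one of the two exponentials alone
        already exceeds \<open>exp (x\<^sup>2 / a)\<close>.\<close>
      then have "x * x \<le> x * \<bar>W \<omega>\<bar>" using A(1) x by (intro mult_left_mono) auto
      then have "x * x \<le> x * W \<omega> \<or> x * x \<le> - x * W \<omega>" by (auto simp: abs_if split: if_splits)
      then have "x\<^sup>2 / a \<le> x * W \<omega> / a \<or> x\<^sup>2 / a \<le> - x * W \<omega> / a"
        using a divide_right_mono[of "x * x" "x * W \<omega>" a] divide_right_mono[of "x * x" "- x * W \<omega>" a]
        unfolding power2_eq_square by argo
      then have "exp (x\<^sup>2 / a) \<le> exp (x * W \<omega> / a) \<or> exp (x\<^sup>2 / a) \<le> exp (- x * W \<omega> / a)"
        by simp
      then have "exp (x\<^sup>2 / a) \<le> exp (x * W \<omega> / a) + exp (- x * W \<omega> / a)"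
        using exp_ge_zero[of "x * W \<omega> / a"] exp_ge_zero[of "- x * W \<omega> / a"] by linarith
      then have "exp (- (x\<^sup>2 / a)) * exp (x\<^sup>2 / a) \<le> exp (- (x\<^sup>2 / a)) * (exp (x * W \<omega> / a) + exp (- x * W \<omega> / a))"
        by (intro mult_left_mono) auto
      then show ?thesis by (simp add: exp_add[symmetric] indicator_def)
    qed (auto simp: indicator_def)
  qed
  also have "\<dots> = exp (- (x\<^sup>2 / a)) * (expectation (\<lambda>\<omega>. exp (x * W \<omega> / a)) + expectation (\<lambda>\<omega>. exp (- x * W \<omega> / a)))"
    using i[of x] i[of "-x"] by simp
  finally show ?thesis .
qed

text \<open>Away from \<open>t\<close> by \<open>\<delta>\<close> or more, moving the parameter by
  \<open>\<delta>\<close> towards the side of \<open>W\<close> increases the integrand up to the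
  stated prefactor. For Gaussian asymptotics both side terms have exponent
  \<open>(t\<^sup>2 / 2 - \<delta>\<^sup>2 / 2) / a\<close> against
  \<open>t\<^sup>2 / (2 * a)\<close> on the left, so the probability has to carry the mass.\<close>

lemma (in prob_space) exponential_tilting:
  fixes W :: "'a \<Rightarrow> real"
  assumes W: "W \<in> borel_measurable M" and a: "a > 0" and \<delta>: "\<delta> > 0"
    and i: "\<And>s. integrable M (\<lambda>\<omega>. exp (s * W \<omega> / a))"
    and A: "ball t \<delta> \<subseteq> A" "A \<in> sets borel"
  shows "expectation (\<lambda>\<omega>. exp (t * W \<omega> / a)) \<le>
    exp ((t\<^sup>2 + \<bar>t\<bar> * \<delta>) / a) * prob {\<omega>\<in>space M. W \<omega> \<in> A}
    + exp (- \<delta> * (t + \<delta>) / a) * expectation (\<lambda>\<omega>. exp ((t + \<delta>) * W \<omega> / a))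
    + exp (\<delta> * (t - \<delta>) / a) * expectation (\<lambda>\<omega>. exp ((t - \<delta>) * W \<omega> / a))"
proof -
  let ?B = "{\<omega>\<in>space M. W \<omega> \<in> A}"
  have Bm: "?B \<in> sets M" using W A(2) by measurable
  have Bi: "integrable M (indicator ?B :: 'a \<Rightarrow> real)"
      by (rule integrable_const_bound[where B=1]) (use Bm in auto)
  have "expectation (\<lambda>\<omega>. exp (t * W \<omega> / a)) \<le>
    expectation (\<lambda>\<omega>. exp ((t\<^sup>2 + \<bar>t\<bar> * \<delta>) / a) * indicator ?B \<omega>
      + exp (- \<delta> * (t + \<delta>) / a) * exp ((t + \<delta>) * W \<omega> / a)
      + exp (\<delta> * (t - \<delta>) / a) * exp ((t - \<delta>) * W \<omega> / a))"
  proof (rule integral_mono)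
    show "integrable M (\<lambda>\<omega>. exp ((t\<^sup>2 + \<bar>t\<bar> * \<delta>) / a) * indicator ?B \<omega>
      + exp (- \<delta> * (t + \<delta>) / a) * exp ((t + \<delta>) * W \<omega> / a)
      + exp (\<delta> * (t - \<delta>) / a) * exp ((t - \<delta>) * W \<omega> / a))"
      using i Bi by auto
    fix \<omega> assume \<omega>: "\<omega> \<in> space M"
    consider "\<bar>W \<omega> - t\<bar> < \<delta>" | "W \<omega> \<ge> t + \<delta>" | "W \<omega> \<le> t - \<delta>" by linarith
    then show "exp (t * W \<omega> / a) \<le> exp ((t\<^sup>2 + \<bar>t\<bar> * \<delta>) / a) * indicator ?B \<omega>
      + exp (- \<delta> * (t + \<delta>) / a) * exp ((t + \<delta>) * W \<omega> / a)
      + exp (\<delta> * (t - \<delta>) / a) * exp ((t - \<delta>) * W \<omega> / a)"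
    proof cases
      case 1
      then have "W \<omega> \<in> ball t \<delta>" by (auto simp: dist_real_def)
      then have "\<omega> \<in> ?B" using A \<omega> by auto
      moreover have "t * (W \<omega> - t) \<le> \<bar>t\<bar> * \<delta>"
      proof -
        have "t * (W \<omega> - t) \<le> \<bar>t\<bar> * \<bar>W \<omega> - t\<bar>" by (metis abs_ge_self abs_mult)
        also have "\<dots> \<le> \<bar>t\<bar> * \<delta>" using 1 by (intro mult_left_mono) auto
        finally show ?thesis .
      qed
      then have "t * W \<omega> / a \<le> (t\<^sup>2 + \<bar>t\<bar> * \<delta>) / a"
        using a by (intro divide_right_mono) (auto simp: algebra_simps power2_eq_square)
      ultimately show ?thesis by (simp add: add_increasing2 add_increasing)
    next
      case 2
      then have "\<delta> * (t + \<delta>) \<le> \<delta> * W \<omega>" using \<delta> by simp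
      then have "t * W \<omega> / a \<le> (- \<delta> * (t + \<delta>) + (t + \<delta>) * W \<omega>) / a"
        using a by (intro divide_right_mono) (auto simp: algebra_simps)
      then have "exp (t * W \<omega> / a) \<le> exp ((- \<delta> * (t + \<delta>) + (t + \<delta>) * W \<omega>) / a)"
        by simp
      then have "exp (t * W \<omega> / a) \<le> exp (- \<delta> * (t + \<delta>) / a) * exp ((t + \<delta>) * W \<omega> / a)"
        unfolding add_divide_distrib exp_add .
      then show ?thesis by (simp add: add_increasing2 add_increasing)
    next
      case 3
      then have "\<delta> * W \<omega> \<le> \<delta> * (t - \<delta>)" using \<delta> by simp
      then have "t * W \<omega> / a \<le> (\<delta> * (t - \<delta>) + (t - \<delta>) * W \<omega>) / a"
        using a by (intro divide_right_mono) (auto simp: algebra_simps)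
      then have "exp (t * W \<omega> / a) \<le> exp ((\<delta> * (t - \<delta>) + (t - \<delta>) * W \<omega>) / a)"
        by simp
      then have "exp (t * W \<omega> / a) \<le> exp (\<delta> * (t - \<delta>) / a) * exp ((t - \<delta>) * W \<omega> / a)"
        unfolding add_divide_distrib exp_add .
      then show ?thesis by (simp add: add_increasing2 add_increasing)
    qed
  qed (rule i)
  also have "\<dots> = exp ((t\<^sup>2 + \<bar>t\<bar> * \<delta>) / a) * prob ?B
    + exp (- \<delta> * (t + \<delta>) / a) * expectation (\<lambda>\<omega>. exp ((t + \<delta>) * W \<omega> / a))
    + exp (\<delta> * (t - \<delta>) / a) * expectation (\<lambda>\<omega>. exp ((t - \<delta>) * W \<omega> / a))"
    using i Bi Bm by simp
  finally show ?thesis .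
qed

lemma good_rate_function_half_square: "good_rate_function (\<lambda>t. ereal (t\<^sup>2 / 2))"
  unfolding good_rate_function_def
proof (intro conjI allI)
  fix r :: real
  have "{t::real. ereal (t\<^sup>2 / 2) \<le> ereal r} = {t. t\<^sup>2 / 2 \<le> r}" by simp
  moreover have "closed {t::real. t\<^sup>2 / 2 \<le> r}"
    by (intro closed_Collect_le continuous_intros) auto
  moreover have "bounded {t::real. t\<^sup>2 / 2 \<le> r}"
  proof (rule boundedI)
    fix t :: real assume "t \<in> {t. t\<^sup>2 / 2 \<le> r}"
    then have "t\<^sup>2 \<le> 2 * r" by auto
    then show "norm t \<le> sqrt (2 * r)" using real_le_rsqrt[of "\<bar>t\<bar>" "2 * r"] by simp
  qed
  ultimately show "compact {t::real. ereal (t\<^sup>2 / 2) \<le> ereal r}"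
    by (simp add: compact_eq_bounded_closed)
qed simp

text \<open>Gaertner--Ellis argument: the upper bound is Chernoff's inequality at
  the point of the closure nearest to 0, the lower bound tilts the law by \<open>exp (t W / a)\<close>.\<close>

lemma gaussian_moderate_deviations:
  fixes P :: "'a measure" and T :: "nat \<Rightarrow> 'a \<Rightarrow> real" and a :: "nat \<Rightarrow> real"
  assumes "prob_space P"
    and T: "\<And>n. n \<ge> 1 \<Longrightarrow> T n \<in> borel_measurable P"
    and a: "\<And>n. n \<ge> 1 \<Longrightarrow> a n > 0" and a0: "a \<longlonglongrightarrow> 0"
    and i: "\<And>s n. n \<ge> 1 \<Longrightarrow> integrable P (\<lambda>\<omega>. exp (s * T n \<omega>))"
    and lim: "\<And>s. (\<lambda>n. a n * ln (prob_space.expectation P (\<lambda>\<omega>. exp (s * T n \<omega> / sqrt (a n)))))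
      \<longlonglongrightarrow> s\<^sup>2 / 2"
  shows "moderate_deviations P T a (\<lambda>t. ereal (t\<^sup>2 / 2))"
proof -
  interpret prob_space P by fact
  \<comment> \<open>With this scaling the exponent \<open>s * T / sqrt a\<close> becomes
    \<open>s * W / a\<close>, the form of the two inequalities above.\<close>
  define W where "W n \<omega> = sqrt (a n) * T n \<omega>" for n \<omega>
  define E where "E n s = expectation (\<lambda>\<omega>. exp (s * W n \<omega> / a n))" for n s
  have We: "s * W n \<omega> / a n = s * T n \<omega> / sqrt (a n)" if "n \<ge> 1" for s n \<omega>
    using a[OF that] by (simp add: W_def field_simps)
  have Wm: "W n \<in> borel_measurable P" if "n \<ge> 1" for n unfolding W_def using T[OF that] by measurable
  have Wi: "integrable P (\<lambda>\<omega>. exp (s * W n \<omega> / a n))" if "n \<ge> 1" for s n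
    using i[OF that, of "s / sqrt (a n)"] We[OF that] by simp
  have Epos: "E n s > 0" if "n \<ge> 1" for n s
  proof -
    have "E n s \<ge> 0" unfolding E_def by simp
    moreover have "E n s \<noteq> 0"
      unfolding E_def using integral_nonneg_eq_0_iff_AE[OF Wi[OF that]] by (simp add: AE_False)
    ultimately show ?thesis by simp
  qed
  have "(\<lambda>n. a n * ln (E n s)) \<longlonglongrightarrow> s\<^sup>2 / 2" for s
    by (rule Lim_transform_eventually[OF lim[of s]])
      (auto intro!: eventually_sequentiallyI[of 1] simp: E_def We)
  then have Eev: "\<forall>\<^sub>F n in sequentially. exp ((s\<^sup>2 / 2 - e) / a n) \<le> E n s \<and> E n s \<le> exp ((s\<^sup>2 / 2 + e) / a n)"
    if "e > 0" for s e
  proof -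
    have "\<forall>\<^sub>F n in sequentially. dist (a n * ln (E n s)) (s\<^sup>2 / 2) < e"
      using \<open>(\<lambda>n. a n * ln (E n s)) \<longlonglongrightarrow> s\<^sup>2 / 2\<close> that by (rule tendstoD)
    then show ?thesis using eventually_ge_at_top[of 1]
    proof eventually_elim
      case (elim n)
      then have "s\<^sup>2 / 2 - e < a n * ln (E n s)" "a n * ln (E n s) < s\<^sup>2 / 2 + e"
        by (auto simp: dist_real_def)
      then have "(s\<^sup>2 / 2 - e) / a n < ln (E n s)" "ln (E n s) < (s\<^sup>2 / 2 + e) / a n"
        using a[OF elim(2)] by (auto simp: field_simps)
      then have "exp ((s\<^sup>2 / 2 - e) / a n) < exp (ln (E n s))" "exp (ln (E n s)) < exp ((s\<^sup>2 / 2 + e) / a n)"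
        by auto
      then show ?case using Epos[OF elim(2)] by auto
    qed
  qed
  define p where "p A n = prob {\<omega>\<in>space P. W n \<omega> \<in> A}" for A n
  have asmall: "\<forall>\<^sub>F n in sequentially. a n < e" if "e > 0" for e
    using order_tendstoD(2)[OF a0 that] .
  have upper: "limsup (\<lambda>n. ereal (a n) * log_prob (p A n)) \<le> - (INF t\<in>closure A. ereal (t\<^sup>2 / 2))"
    if A: "A \<in> sets borel" for A
  proof (cases "A = {}")
    case True
    have "limsup (\<lambda>n. ereal (a n) * log_prob (p A n)) \<le> -\<infinity>"
    proof (rule Limsup_bounded, rule eventually_sequentiallyI)
      fix n :: nat assume "1 \<le> n"
      then show "ereal (a n) * log_prob (p A n) \<le> -\<infinity>"
        using a[of n] True by (simp add: p_def log_prob_def)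
    qed
    then show ?thesis using True by simp
  next
    case False
    \<comment> \<open>The rate increases with the modulus, so its infimum over the closure is
      attained at the point nearest to 0, and the two-sided bound at that distance covers all of
      \<open>A\<close>.\<close>
    obtain t0 where t0: "t0 \<in> closure A" "\<And>t. t \<in> closure A \<Longrightarrow> dist 0 t0 \<le> dist 0 t"
      using distance_attains_inf[OF closed_closure[of A], of 0] False by auto
    define x where "x = \<bar>t0\<bar>"
    have x: "x \<ge> 0" "\<And>t. t \<in> A \<Longrightarrow> x \<le> \<bar>t\<bar>"
      using t0(2) closure_subset[of A] by (auto simp: x_def)
    have "limsup (\<lambda>n. ereal (a n) * log_prob (p A n)) \<le> ereal (- (x\<^sup>2 / 2))"
    proof (rule ereal_le_epsilon2)
      fix e :: real assume e: "0 < e"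
      have "limsup (\<lambda>n. ereal (a n) * log_prob (p A n)) \<le> ereal (- (x\<^sup>2 / 2) + e)"
      proof (rule Limsup_bounded)
        have e2: "e / 2 > 0" using e by simp
        show "\<forall>\<^sub>F n in sequentially. ereal (a n) * log_prob (p A n) \<le> ereal (- (x\<^sup>2 / 2) + e)"
          using Eev[OF e2, of x] Eev[OF e2, of "-x"] asmall[OF e2] eventually_ge_at_top[of 1]
        proof eventually_elim
          case (elim n)
          note an = a[OF elim(4)]
          show ?case
          proof (cases "p A n = 0")
            case True
            then show ?thesis using an by (simp add: log_prob_def)
          next
            case False
            then have pp: "p A n > 0" using measure_nonneg[of P] unfolding p_def by (simp add: less_le)
            have "p A n \<le> exp (- (x\<^sup>2 / a n)) * (E n x + E n (- x))"
              unfolding p_def E_def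
              by (rule chernoff_two_sided[OF Wm[OF elim(4)] an x(1) Wi[OF elim(4)] x(2) A]) auto
            also have "\<dots> \<le> exp (- (x\<^sup>2 / a n)) * (2 * exp ((x\<^sup>2 / 2 + e / 2) / a n))"
              using elim by (intro mult_left_mono) auto
            also have "\<dots> = 2 * exp ((- (x\<^sup>2 / 2) + e / 2) / a n)"
              using an by (simp add: exp_add[symmetric] field_simps)
            finally have "ln (p A n) \<le> ln (2 * exp ((- (x\<^sup>2 / 2) + e / 2) / a n))"
              using pp by (intro ln_mono) auto
            also have "\<dots> = ln 2 + (- (x\<^sup>2 / 2) + e / 2) / a n" by (simp add: ln_mult)
            finally have "a n * ln (p A n) \<le> a n * (ln 2 + (- (x\<^sup>2 / 2) + e / 2) / a n)"
              using an by (intro mult_left_mono) auto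
            also have "\<dots> = a n * ln 2 + (- (x\<^sup>2 / 2) + e / 2)" using an by (simp add: field_simps)
            also have "a n * ln 2 \<le> a n * 1" using an ln_2_less_1 by (intro mult_left_mono) auto
            finally have "a n * ln (p A n) \<le> - (x\<^sup>2 / 2) + e" using elim by linarith
            then show ?thesis using False by (simp add: log_prob_def)
          qed
        qed
      qed
      then show "limsup (\<lambda>n. ereal (a n) * log_prob (p A n)) \<le> ereal (- (x\<^sup>2 / 2)) + ereal e" by simp
    qed
    also have "\<dots> = - ereal (t0\<^sup>2 / 2)" by (simp add: x_def)
    also have "\<dots> \<le> - (INF t\<in>closure A. ereal (t\<^sup>2 / 2))"
      unfolding ereal_minus_le_minus using t0(1) by (rule INF_lower)
    finally show ?thesis .
  qed
  have lower: "- (INF t\<in>interior A. ereal (t\<^sup>2 / 2)) \<le> liminf (\<lambda>n. ereal (a n) * log_prob (p A n))"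
    if A: "A \<in> sets borel" for A
  proof -
    let ?L = "liminf (\<lambda>n. ereal (a n) * log_prob (p A n))"
    have "- ?L \<le> ereal (t\<^sup>2 / 2)" if t: "t \<in> interior A" for t
    proof -
      obtain r where r: "r > 0" "ball t r \<subseteq> A" using t by (meson mem_interior)
      have "ereal (- (t\<^sup>2 / 2)) \<le> ?L"
      proof (rule ereal_le_epsilon2)
        fix e :: real assume e: "0 < e"
        \<comment> \<open>At most \<open>r\<close> keeps the ball inside \<open>A\<close>, at most 1
          gives \<open>\<delta>\<^sup>2 \<le> \<delta>\<close>, and the last bound keeps
          \<open>\<bar>t\<bar> * \<delta>\<close> and \<open>\<delta>\<close> below
          \<open>e / 3\<close>.\<close>
        define \<delta> where "\<delta> = min (min r 1) (e / (3 * (\<bar>t\<bar> + 1)))"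
        have \<delta>: "\<delta> > 0" "\<delta> \<le> r" "\<delta> \<le> 1" "\<delta> \<le> e / (3 * (\<bar>t\<bar> + 1))"
          using r e by (auto simp: \<delta>_def)
        then have \<delta>e: "\<delta> * (3 * (\<bar>t\<bar> + 1)) \<le> e" by (simp add: pos_le_divide_eq)
        then have d3: "\<bar>t\<bar> * \<delta> \<le> e / 3" "\<delta> \<le> e / 3"
        proof -
          have "\<bar>t\<bar> * \<delta> \<ge> 0" using \<delta> by simp
          moreover have "\<delta> * (3 * (\<bar>t\<bar> + 1)) = 3 * (\<bar>t\<bar> * \<delta>) + 3 * \<delta>" by (simp add: algebra_simps)
          ultimately show "\<bar>t\<bar> * \<delta> \<le> e / 3" "\<delta> \<le> e / 3" using \<delta>e \<delta>(1) by linarith+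
        qed
        \<comment> \<open>The side terms lose \<open>\<delta>\<^sup>2 / 2\<close> in the exponent,
          and the tolerance \<open>\<eta>\<close> is spent once on them and once on the left side: a
          margin of \<open>\<delta>\<^sup>2 / 4\<close> remains.\<close>
        define \<eta> where "\<eta> = \<delta>\<^sup>2 / 8"
        have \<eta>: "\<eta> > 0" "\<eta> \<le> e / 3"
        proof -
          show "\<eta> > 0" using \<delta> by (simp add: \<eta>_def)
          have "\<delta>\<^sup>2 \<le> \<delta>" using \<delta> by (simp add: power2_eq_square mult_left_le)
          then show "\<eta> \<le> e / 3" using d3 \<delta>(1) unfolding \<eta>_def by linarith
        qed
        \<comment> \<open>Below \<open>\<delta>\<^sup>2 / 16\<close> the margin gives a factor
          \<open>exp (- 4)\<close> or better, at most 1/4, so the two side terms take at most half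
          of the total. The other bound absorbs \<open>a n * ln 2\<close>.\<close>
        have as: "min (e / 3) (\<delta>\<^sup>2 / 16) > 0" using e \<delta> by simp
        have "ereal (- (t\<^sup>2 / 2) - e) \<le> ?L"
        proof (rule Liminf_bounded)
          show "\<forall>\<^sub>F n in sequentially. ereal (- (t\<^sup>2 / 2) - e) \<le> ereal (a n) * log_prob (p A n)"
            using Eev[OF \<eta>(1), of t] Eev[OF \<eta>(1), of "t + \<delta>"] Eev[OF \<eta>(1), of "t - \<delta>"]
              asmall[OF as] eventually_ge_at_top[of 1]
          proof eventually_elim
            case (elim n)
            note an = a[OF elim(5)]
            let ?x = "exp ((t\<^sup>2 / 2 - \<eta>) / a n)"
            have q4: "exp (- \<delta>\<^sup>2 / (4 * a n)) \<le> 1 / 4"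
            proof -
              have "\<delta>\<^sup>2 / (4 * a n) \<ge> 4" using elim(4) an by (simp add: field_simps)
              then have "exp (\<delta>\<^sup>2 / (4 * a n)) \<ge> 4" using exp_ge_add_one_self[of "\<delta>\<^sup>2 / (4 * a n)"] by linarith
              then show ?thesis by (simp add: exp_minus field_simps)
            qed
            have sm: "exp (u / a n) * exp (((t\<^sup>2 / 2 - \<delta>\<^sup>2 / 2 - u) + \<eta>) / a n) \<le> ?x / 4" for u
            proof -
              have "exp (u / a n) * exp (((t\<^sup>2 / 2 - \<delta>\<^sup>2 / 2 - u) + \<eta>) / a n) = ?x * exp (- \<delta>\<^sup>2 / (4 * a n))"
                unfolding exp_add[symmetric] \<eta>_def using an by (simp add: field_simps)
              also have "\<dots> \<le> ?x * (1 / 4)" using q4 by (intro mult_left_mono) auto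
              finally show ?thesis by simp
            qed
            have "E n t \<le> exp ((t\<^sup>2 + \<bar>t\<bar> * \<delta>) / a n) * p A n
              + exp (- \<delta> * (t + \<delta>) / a n) * E n (t + \<delta>) + exp (\<delta> * (t - \<delta>) / a n) * E n (t - \<delta>)"
              unfolding p_def E_def
              by (rule exponential_tilting[OF Wm[OF elim(5)] an \<delta>(1) Wi[OF elim(5)] _ A]) (use r(2) \<delta>(2) in auto)
            moreover have "exp (- \<delta> * (t + \<delta>) / a n) * E n (t + \<delta>) \<le> ?x / 4"
            proof -
              have "exp (- \<delta> * (t + \<delta>) / a n) * E n (t + \<delta>) \<le>
                exp (- \<delta> * (t + \<delta>) / a n) * exp (((t + \<delta>)\<^sup>2 / 2 + \<eta>) / a n)"
                using elim by (intro mult_left_mono) auto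
              also have "(t + \<delta>)\<^sup>2 / 2 + \<eta> = t\<^sup>2 / 2 - \<delta>\<^sup>2 / 2 - (- \<delta> * (t + \<delta>)) + \<eta>"
                by (simp add: power2_eq_square field_simps)
              finally show ?thesis using sm[of "- \<delta> * (t + \<delta>)"] by linarith
            qed
            moreover have "exp (\<delta> * (t - \<delta>) / a n) * E n (t - \<delta>) \<le> ?x / 4"
            proof -
              have "exp (\<delta> * (t - \<delta>) / a n) * E n (t - \<delta>) \<le>
                exp (\<delta> * (t - \<delta>) / a n) * exp (((t - \<delta>)\<^sup>2 / 2 + \<eta>) / a n)"
                using elim by (intro mult_left_mono) auto
              also have "(t - \<delta>)\<^sup>2 / 2 + \<eta> = t\<^sup>2 / 2 - \<delta>\<^sup>2 / 2 - (\<delta> * (t - \<delta>)) + \<eta>"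
                by (simp add: power2_eq_square field_simps)
              finally show ?thesis using sm[of "\<delta> * (t - \<delta>)"] by linarith
            qed
            ultimately have h: "?x / 2 \<le> exp ((t\<^sup>2 + \<bar>t\<bar> * \<delta>) / a n) * p A n" using elim by linarith
            have xp: "?x > 0" by simp
            have pp: "p A n > 0"
            proof (rule ccontr)
              assume "\<not> p A n > 0"
              then have "exp ((t\<^sup>2 + \<bar>t\<bar> * \<delta>) / a n) * p A n \<le> 0" by (simp add: mult_le_0_iff)
              then show False using h xp by linarith
            qed
            have "ln (?x / 2) \<le> ln (exp ((t\<^sup>2 + \<bar>t\<bar> * \<delta>) / a n) * p A n)"
              using h by (intro ln_mono) auto
            then have "(t\<^sup>2 / 2 - \<eta>) / a n - ln 2 \<le> (t\<^sup>2 + \<bar>t\<bar> * \<delta>) / a n + ln (p A n)"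
              using pp by (simp add: ln_mult ln_div)
            then have "a n * ((t\<^sup>2 / 2 - \<eta>) / a n - ln 2) \<le> a n * ((t\<^sup>2 + \<bar>t\<bar> * \<delta>) / a n + ln (p A n))"
              using an by (intro mult_left_mono) auto
            then have "t\<^sup>2 / 2 - \<eta> - a n * ln 2 \<le> t\<^sup>2 + \<bar>t\<bar> * \<delta> + a n * ln (p A n)"
              unfolding right_diff_distrib[of "a n" "_ / _"] distrib_left[of "a n" "_ / _"] using an by simp
            moreover have "a n * ln 2 \<le> a n * 1" using an ln_2_less_1 by (intro mult_left_mono) auto
            ultimately have "- (t\<^sup>2 / 2) - e \<le> a n * ln (p A n)" using elim(4) d3(1) \<eta>(2) by linarith
            then show ?case using pp by (simp add: log_prob_def)
          qed
        qed
        then have "ereal (- (t\<^sup>2 / 2) - e) + ereal e \<le> ?L + ereal e" by (rule add_right_mono)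
        then show "ereal (- (t\<^sup>2 / 2)) \<le> ?L + ereal e" by simp
      qed
      then show ?thesis by (simp add: ereal_uminus_le_reorder)
    qed
    then have "- ?L \<le> (INF t\<in>interior A. ereal (t\<^sup>2 / 2))" by (intro INF_greatest) auto
    then show ?thesis by (simp add: ereal_uminus_le_reorder)
  qed
  show ?thesis
    unfolding moderate_deviations_def using a0 upper lower unfolding p_def W_def by auto
qed

section \<open>Covariance inequality and log-Laplace transforms\<close>

text \<open>With \<open>W\<close> the conditional expectation of \<open>V\<close> given
  \<open>F\<close>, minus the mean, the covariance is \<open>E (U W)\<close>, at most
  \<open>a\<close> times \<open>E |W|\<close>. The sign of \<open>W\<close> is
  \<open>2 * indicator A - 1\<close> with \<open>A\<close> in \<open>F\<close>, so
  \<open>E |W|\<close> is again a covariance with \<open>V\<close>; the constant -1 contributes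
  nothing to it, which leaves the factor 2.\<close>

lemma (in prob_space) cov_le_indicator_cov:
  assumes F: "subalgebra M F"
    and U: "U \<in> borel_measurable F" "\<And>x. \<bar>U x\<bar> \<le> (a::real)"
    and V: "integrable M V"
  shows "\<exists>A\<in>sets F. \<bar>expectation (\<lambda>x. U x * V x) - expectation U * expectation V\<bar>
    \<le> 2 * a * \<bar>expectation (\<lambda>x. indicator A x * V x) - prob A * expectation V\<bar>"
proof -
  interpret fs: finite_measure_subalgebra M F by (unfold_locales) (rule F)
  have a0: "a \<ge> 0" using U(2)[of undefined] by linarith
  have sF: "sets F \<subseteq> sets M" "space F = space M" using F by (auto simp: subalgebra_def)
  have mF: "f \<in> borel_measurable M" if "f \<in> borel_measurable F" for f :: "'a \<Rightarrow> real"
    using that F by (rule measurable_from_subalg[rotated])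
  define W where "W x = real_cond_exp M F V x - expectation V" for x
  have WF[measurable]: "W \<in> borel_measurable F" unfolding W_def by measurable
  have Wi: "integrable M W" unfolding W_def using fs.real_cond_exp_int(1)[OF V] by simp
  have key: "integrable M (\<lambda>x. f x * W x) \<and>
      expectation (\<lambda>x. f x * W x) = expectation (\<lambda>x. f x * V x) - expectation f * expectation V"
    if f: "f \<in> borel_measurable F" "\<And>x. \<bar>f x\<bar> \<le> b" for f and b :: real
  proof -
    have fm: "f \<in> borel_measurable M" using f mF by blast
    have fi: "integrable M f" by (rule integrable_const_bound[where B=b]) (use f fm in auto)
    have fVi: "integrable M (\<lambda>x. f x * V x)"
      by (rule Bochner_Integration.integrable_bound[where f="\<lambda>x. b * V x"])
        (use V fm f(2) in \<open>auto simp: abs_mult intro!: mult_mono order_trans[OF f(2)]\<close>)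
    note g = fs.real_cond_exp_intg[OF fVi f(1) borel_measurable_integrable[OF V]]
    have e: "f x * W x = f x * real_cond_exp M F V x - f x * expectation V" for x
      by (simp add: W_def algebra_simps)
    show ?thesis unfolding e using g fi by simp
  qed
  define A where "A = {x\<in>space F. W x \<ge> 0}"
  have A: "A \<in> sets F" unfolding A_def by measurable
  define \<xi> where "\<xi> x = 2 * indicator A x - (1::real)" for x
  have xF: "\<xi> \<in> borel_measurable F" unfolding \<xi>_def using A by measurable
  have xb: "\<bar>\<xi> x\<bar> \<le> 1" for x unfolding \<xi>_def by (auto simp: indicator_def)
  have Am: "A \<in> sets M" using A sF by auto
  have "\<bar>expectation (\<lambda>x. U x * V x) - expectation U * expectation V\<bar> = \<bar>expectation (\<lambda>x. U x * W x)\<bar>"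
    using key[OF U] by simp
  also have "\<dots> \<le> expectation (\<lambda>x. \<bar>U x * W x\<bar>)" by (rule integral_abs_bound)
  also have "\<dots> \<le> expectation (\<lambda>x. a * (\<xi> x * W x))"
  proof (rule integral_mono)
    show "integrable M (\<lambda>x. \<bar>U x * W x\<bar>)" using key[OF U] by auto
    show "integrable M (\<lambda>x. a * (\<xi> x * W x))" using key[OF xF xb] by auto
    fix x assume "x \<in> space M"
    then have "\<xi> x * W x = \<bar>W x\<bar>" unfolding \<xi>_def A_def using sF(2) by (auto simp: indicator_def)
    then show "\<bar>U x * W x\<bar> \<le> a * (\<xi> x * W x)" using U(2) by (auto simp: abs_mult intro!: mult_right_mono)
  qed
  also have "\<dots> = a * (expectation (\<lambda>x. \<xi> x * V x) - expectation \<xi> * expectation V)"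
    using key[OF xF xb] by simp
  also have "expectation \<xi> = 2 * prob A - 1" 
  proof -
    have "integrable M (indicator A :: 'a \<Rightarrow> real)"
      by (rule integrable_const_bound[where B=1]) (use Am in auto)
    then show ?thesis unfolding \<xi>_def using Am by (simp add: prob_space)
  qed
  also have "expectation (\<lambda>x. \<xi> x * V x) = 2 * expectation (\<lambda>x. indicator A x * V x) - expectation V"
  proof -
    have "integrable M (\<lambda>x. indicator A x * V x)" using integrable_mult_indicator[OF Am V] by simp
    moreover have "\<xi> x * V x = 2 * (indicator A x * V x) - V x" for x by (simp add: \<xi>_def algebra_simps)
    ultimately show ?thesis using V by simp
  qed
  finally have "\<bar>expectation (\<lambda>x. U x * V x) - expectation U * expectation V\<bar> \<le>
    2 * a * (expectation (\<lambda>x. indicator A x * V x) - prob A * expectation V)"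
    by (simp add: algebra_simps)
  also have "\<dots> \<le> 2 * a * \<bar>expectation (\<lambda>x. indicator A x * V x) - prob A * expectation V\<bar>"
    using a0 by (intro mult_left_mono) auto
  finally show ?thesis using A by blast
qed

text \<open>The reduction to an indicator is applied to \<open>U\<close>, then with exchanged roles
  to \<open>V\<close>; each costs a factor 2, and a covariance of two events remains.\<close>

lemma (in prob_space) cov_le_mixing:
  assumes F: "subalgebra M F" and G: "subalgebra M G"
    and mix: "\<And>A B. A \<in> sets F \<Longrightarrow> B \<in> sets G \<Longrightarrow> \<bar>prob (A \<inter> B) - prob A * prob B\<bar> \<le> \<alpha>"
    and U: "U \<in> borel_measurable F" "\<And>x. \<bar>U x\<bar> \<le> (a::real)"
    and V: "V \<in> borel_measurable G" "\<And>x. \<bar>V x\<bar> \<le> (b::real)"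
  shows "\<bar>expectation (\<lambda>x. U x * V x) - expectation U * expectation V\<bar> \<le> 4 * \<alpha> * a * b"
proof -
  have a0: "a \<ge> 0" using U(2)[of undefined] by linarith
  have b0: "b \<ge> 0" using V(2)[of undefined] by linarith
  have Vi: "integrable M V"
    by (rule integrable_const_bound[where B=b]) (use V measurable_from_subalg[OF G] in auto)
  obtain A where A: "A \<in> sets F" "\<bar>expectation (\<lambda>x. U x * V x) - expectation U * expectation V\<bar>
    \<le> 2 * a * \<bar>expectation (\<lambda>x. indicator A x * V x) - prob A * expectation V\<bar>"
    using cov_le_indicator_cov[OF F U Vi] by blast
  have Am: "A \<in> sets M" using A F by (auto simp: subalgebra_def)
  have Ii: "integrable M (indicator A :: 'a \<Rightarrow> real)"
    by (rule integrable_const_bound[where B=1]) (use Am in auto)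
  obtain B where B: "B \<in> sets G" "\<bar>expectation (\<lambda>x. V x * indicator A x) - expectation V * expectation (indicator A)\<bar>
    \<le> 2 * b * \<bar>expectation (\<lambda>x. indicator B x * indicator A x) - prob B * expectation (indicator A)\<bar>"
    using cov_le_indicator_cov[OF G V Ii] by blast
  have Bm: "B \<in> sets M" using B G by (auto simp: subalgebra_def)
  have e: "expectation (\<lambda>x. indicator B x * indicator A x) = prob (A \<inter> B)"
    using Am Bm by (simp add: indicator_inter_arith[symmetric] Int_commute)
  have "\<bar>prob (A \<inter> B) - prob B * prob A\<bar> \<le> \<alpha>" using mix[OF A(1) B(1)] by (simp add: mult.commute)
  then have "2 * b * \<bar>prob (A \<inter> B) - prob B * prob A\<bar> \<le> 2 * b * \<alpha>"
    using b0 by (intro mult_left_mono) auto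
  moreover have "\<bar>expectation (\<lambda>x. indicator A x * V x) - prob A * expectation V\<bar>
      \<le> 2 * b * \<bar>prob (A \<inter> B) - prob B * prob A\<bar>"
    using B(2) Am unfolding e by (simp add: mult.commute)
  ultimately have "\<bar>expectation (\<lambda>x. indicator A x * V x) - prob A * expectation V\<bar> \<le> 2 * b * \<alpha>"
    by linarith
  then have "2 * a * \<bar>expectation (\<lambda>x. indicator A x * V x) - prob A * expectation V\<bar> \<le> 2 * a * (2 * b * \<alpha>)"
    using a0 by (intro mult_left_mono) auto
  then show ?thesis using A(2) by (simp add: algebra_simps)
qed

section \<open>Log-Laplace transforms of bounded variables\<close>

definition (in prob_space) log_laplace :: "('a \<Rightarrow> real) \<Rightarrow> real" where
  "log_laplace Z = ln (expectation (\<lambda>\<omega>. exp (Z \<omega>)))"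

context prob_space
begin

lemma integrable_exp_bounded:
  assumes "Z \<in> borel_measurable M" "\<And>\<omega>. \<bar>Z \<omega>\<bar> \<le> (b::real)"
  shows "integrable M (\<lambda>\<omega>. exp (Z \<omega>))"
proof (rule integrable_const_bound[where B="exp b"])
  show "AE \<omega> in M. norm (exp (Z \<omega>)) \<le> exp b"
    using assms(2) by (auto simp: abs_le_iff)
qed (use assms in measurable)

lemma expectation_exp_pos:
  assumes "Z \<in> borel_measurable M" "\<And>\<omega>. \<bar>Z \<omega>\<bar> \<le> (b::real)"
  shows "expectation (\<lambda>\<omega>. exp (Z \<omega>)) > 0"
proof -
  have "exp (- b) = expectation (\<lambda>\<omega>. exp (- b))" by (simp add: prob_space)
  also have "\<dots> \<le> expectation (\<lambda>\<omega>. exp (Z \<omega>))"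
    using assms(2) by (intro integral_mono integrable_exp_bounded[OF assms]) (auto simp: abs_le_iff minus_le_iff)
  finally show ?thesis using exp_gt_zero[of "- b"] by linarith
qed

text \<open>From \<open>exp z \<ge> 1 + z\<close>. Thanks to this bound an additive error in a
  product of Laplace transforms is also a relative one and passes to the logarithm.\<close>

lemma expectation_exp_ge_1:
  assumes "Z \<in> borel_measurable M" "\<And>\<omega>. \<bar>Z \<omega>\<bar> \<le> (b::real)" "expectation Z = 0"
  shows "1 \<le> expectation (\<lambda>\<omega>. exp (Z \<omega>))"
proof -
  have "integrable M Z" by (rule integrable_const_bound[where B=b]) (use assms in auto)
  then have "expectation (\<lambda>\<omega>. 1 + Z \<omega>) = 1" using assms(3) by (simp add: prob_space)
  moreover have "expectation (\<lambda>\<omega>. 1 + Z \<omega>) \<le> expectation (\<lambda>\<omega>. exp (Z \<omega>))"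
    using \<open>integrable M Z\<close>
    by (intro integral_mono integrable_exp_bounded[OF assms(1,2)]) auto
  ultimately show ?thesis by simp
qed

text \<open>Hoelder's inequality in logarithmic form: each exponential is normalised to expectation
  1, then convexity of \<open>exp\<close> is used pointwise. No independence enters, so it can
  separate the kept from the removed indices.\<close>

lemma log_laplace_convex:
  assumes Z1: "Z1 \<in> borel_measurable M" "\<And>\<omega>. \<bar>Z1 \<omega>\<bar> \<le> (b1::real)"
    and Z2: "Z2 \<in> borel_measurable M" "\<And>\<omega>. \<bar>Z2 \<omega>\<bar> \<le> (b2::real)"
    and w: "0 \<le> w" "w \<le> 1"
  shows "log_laplace (\<lambda>\<omega>. w * Z1 \<omega> + (1 - w) * Z2 \<omega>) \<le> w * log_laplace Z1 + (1 - w) * log_laplace Z2"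
proof -
  let ?l = "w * log_laplace Z1 + (1 - w) * log_laplace Z2"
  have i1: "integrable M (\<lambda>\<omega>. exp (Z1 \<omega>))" and i2: "integrable M (\<lambda>\<omega>. exp (Z2 \<omega>))"
    using integrable_exp_bounded[OF Z1] integrable_exp_bounded[OF Z2] by auto
  note p1 = expectation_exp_pos[OF Z1] and p2 = expectation_exp_pos[OF Z2]
  define Z where "Z \<omega> = w * Z1 \<omega> + (1 - w) * Z2 \<omega>" for \<omega>
  have Zm: "Z \<in> borel_measurable M" unfolding Z_def using Z1 Z2 by measurable
  have Zb: "\<bar>Z \<omega>\<bar> \<le> b1 + b2" for \<omega>
  proof -
    have "\<bar>w * Z1 \<omega>\<bar> \<le> 1 * b1" "\<bar>(1 - w) * Z2 \<omega>\<bar> \<le> 1 * b2"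
      unfolding abs_mult using w Z1(2)[of \<omega>] Z2(2)[of \<omega>] by (intro mult_mono; auto)+
    then show ?thesis unfolding Z_def by linarith
  qed
  have "expectation (\<lambda>\<omega>. exp (Z \<omega>)) \<le> exp ?l * (w * (expectation (\<lambda>\<omega>. exp (Z1 \<omega>)) * exp (- log_laplace Z1))
      + (1 - w) * (expectation (\<lambda>\<omega>. exp (Z2 \<omega>)) * exp (- log_laplace Z2)))" (is "_ \<le> ?r")
  proof -
    have "expectation (\<lambda>\<omega>. exp (Z \<omega>)) \<le> expectation (\<lambda>\<omega>. exp ?l * (w * (exp (Z1 \<omega>) * exp (- log_laplace Z1))
        + (1 - w) * (exp (Z2 \<omega>) * exp (- log_laplace Z2))))"
    proof (rule integral_mono)
      fix \<omega>
      have "exp (w * (Z1 \<omega> - log_laplace Z1) + (1 - w) * (Z2 \<omega> - log_laplace Z2))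
        \<le> w * exp (Z1 \<omega> - log_laplace Z1) + (1 - w) * exp (Z2 \<omega> - log_laplace Z2)"
        using convex_onD[OF exp_convex, of "1 - w" "Z1 \<omega> - log_laplace Z1" "Z2 \<omega> - log_laplace Z2"] w
        by simp
      then have "exp ?l * exp (w * (Z1 \<omega> - log_laplace Z1) + (1 - w) * (Z2 \<omega> - log_laplace Z2))
        \<le> exp ?l * (w * exp (Z1 \<omega> - log_laplace Z1) + (1 - w) * exp (Z2 \<omega> - log_laplace Z2))"
        by (intro mult_left_mono) auto
      moreover have "exp ?l * exp (w * (Z1 \<omega> - log_laplace Z1) + (1 - w) * (Z2 \<omega> - log_laplace Z2)) = exp (Z \<omega>)"
        unfolding exp_add[symmetric] Z_def by (simp add: algebra_simps)
      ultimately show "exp (Z \<omega>) \<le> exp ?l * (w * (exp (Z1 \<omega>) * exp (- log_laplace Z1))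
        + (1 - w) * (exp (Z2 \<omega>) * exp (- log_laplace Z2)))"
        by (simp add: exp_diff exp_minus divide_inverse)
    qed (use i1 i2 integrable_exp_bounded[OF Zm Zb] in auto)
    also have "\<dots> = ?r" using i1 i2 by simp
    finally show ?thesis .
  qed
  also have "?r = exp ?l" using p1 p2 by (simp add: log_laplace_def exp_minus)
  finally have "expectation (\<lambda>\<omega>. exp (Z \<omega>)) \<le> exp ?l" .
  then have "ln (expectation (\<lambda>\<omega>. exp (Z \<omega>))) \<le> ln (exp ?l)"
    using expectation_exp_pos[OF Zm Zb] by (intro ln_mono) auto
  then show ?thesis unfolding log_laplace_def[of "\<lambda>\<omega>. w * Z1 \<omega> + (1 - w) * Z2 \<omega>"] Z_def by simp
qed

text \<open>Taylor's formula for \<open>exp\<close> gives \<open>1 + q / 2\<close> up to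
  \<open>b * q\<close>, with \<open>q\<close> the second moment; the error of
  \<open>ln (1 + x)\<close> is of order \<open>q^2\<close>, hence of order \<open>b^2 * q\<close>.
  The error is relative to \<open>q\<close>, so it adds up over blocks without a contribution per
  block.\<close>

lemma log_laplace_second_order:
  assumes Z: "Z \<in> borel_measurable M" "\<And>\<omega>. \<bar>Z \<omega>\<bar> \<le> (b::real)" "expectation Z = 0"
    and b: "b \<le> 1 / 2"
  shows "\<bar>log_laplace Z - expectation (\<lambda>\<omega>. (Z \<omega>)\<^sup>2) / 2\<bar> \<le> 3 * b * expectation (\<lambda>\<omega>. (Z \<omega>)\<^sup>2)"
proof -
  have b0: "b \<ge> 0" using Z(2)[of undefined] by linarith
  let ?q = "expectation (\<lambda>\<omega>. (Z \<omega>)\<^sup>2)"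
  have Zi: "integrable M Z" by (rule integrable_const_bound[where B=b]) (use Z in auto)
  have sq: "(Z \<omega>)\<^sup>2 \<le> b\<^sup>2" for \<omega> using Z(2) power_mono[of "\<bar>Z \<omega>\<bar>" b 2] by auto
  have Z2i: "integrable M (\<lambda>\<omega>. (Z \<omega>)\<^sup>2)"
    by (rule integrable_const_bound[where B="b\<^sup>2"]) (use Z(1) sq in auto)
  have q0: "?q \<ge> 0" by simp
  have qb: "?q \<le> b\<^sup>2"
  proof -
    have "?q \<le> expectation (\<lambda>\<omega>. b\<^sup>2)" using sq Z2i by (intro integral_mono) auto
    then show ?thesis by (simp add: prob_space)
  qed
  have ei: "integrable M (\<lambda>\<omega>. exp (Z \<omega>))" by (rule integrable_exp_bounded[OF Z(1,2)])
  have pt: "\<bar>exp z - (1 + z + z\<^sup>2 / 2)\<bar> \<le> b * z\<^sup>2" if z: "\<bar>z\<bar> \<le> b" for z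
  proof -
    obtain u where u: "\<bar>u\<bar> \<le> \<bar>z\<bar>" "exp z = (\<Sum>m<3. z ^ m / fact m) + exp u / fact 3 * z ^ 3"
      using Maclaurin_exp_le[of z 3] by blast
    have "(\<Sum>m<3. z ^ m / fact m) = 1 + z + z\<^sup>2 / 2"
      by (simp add: numeral_3_eq_3 fact_numeral power2_eq_square)
    then have "exp z - (1 + z + z\<^sup>2 / 2) = exp u / 6 * z ^ 3" using u(2) by (simp add: fact_numeral)
    then have "\<bar>exp z - (1 + z + z\<^sup>2 / 2)\<bar> = exp u / 6 * \<bar>z\<bar> * z\<^sup>2"
      by (simp only: abs_mult power3_eq_cube power2_eq_square) (simp add: abs_mult mult.assoc)
    also have "\<dots> \<le> 1 * b * z\<^sup>2"
    proof (intro mult_right_mono mult_mono)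
      have "u \<le> 1" using u(1) z b by linarith
      then have "exp u \<le> exp 1" by simp
      then show "exp u / 6 \<le> 1" using exp_le by linarith
    qed (use z b0 in auto)
    finally show ?thesis by simp
  qed
  define x where "x = expectation (\<lambda>\<omega>. exp (Z \<omega>)) - 1"
  have "x - ?q / 2 = expectation (\<lambda>\<omega>. exp (Z \<omega>) - (1 + Z \<omega> + (Z \<omega>)\<^sup>2 / 2))"
    unfolding x_def using ei Zi Z2i Z(3) by (simp add: prob_space)
  also have "\<bar>\<dots>\<bar> \<le> expectation (\<lambda>\<omega>. \<bar>exp (Z \<omega>) - (1 + Z \<omega> + (Z \<omega>)\<^sup>2 / 2)\<bar>)" by (rule integral_abs_bound)
  also have "\<dots> \<le> expectation (\<lambda>\<omega>. b * (Z \<omega>)\<^sup>2)"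
    by (intro integral_mono pt Z(2)) (use ei Zi Z2i in auto)
  also have "\<dots> = b * ?q" by simp
  finally have x1: "\<bar>x - ?q / 2\<bar> \<le> b * ?q" .
  have bq: "b * ?q \<le> 1 / 2 * ?q" using b q0 by (intro mult_right_mono) auto
  have x0: "0 \<le> x" using expectation_exp_ge_1[OF Z] by (simp add: x_def)
  have xq: "x \<le> 3 / 2 * ?q" using x1 bq by (auto simp: abs_le_iff)
  have b14: "b\<^sup>2 \<le> 1 / 4" using power_mono[OF b b0, of 2] by (simp add: power2_eq_square)
  have "\<bar>ln (1 + x) - x\<bar> \<le> x\<^sup>2"
    by (rule abs_ln_one_plus_x_minus_x_bound_nonneg) (use x0 xq qb b14 in linarith)+
  also have "x\<^sup>2 \<le> (3 / 2 * ?q)\<^sup>2" using x0 xq by (intro power_mono)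
  also have "\<dots> = 9 / 4 * (?q * ?q)" by (simp add: power2_eq_square)
  also have "\<dots> \<le> 9 / 4 * (b\<^sup>2 * ?q)" using qb q0 by (intro mult_left_mono mult_right_mono) auto
  also have "\<dots> = 9 / 4 * (b * (b * ?q))" by (simp add: power2_eq_square)
  also have "\<dots> \<le> 9 / 4 * (1 / 2 * (b * ?q))" using b b0 q0 by (intro mult_left_mono mult_right_mono) auto
  finally have "\<bar>ln (1 + x) - x\<bar> \<le> 9 / 8 * (b * ?q)" by simp
  moreover have "log_laplace Z = ln (1 + x)" by (simp add: log_laplace_def x_def)
  moreover have "b * ?q \<ge> 0" using b0 q0 by simp
  ultimately show ?thesis using x1 unfolding abs_le_iff by linarith
qed

end

section \<open>Cutting finite index sets around a gap\<close>

lemma initial_segment_exists: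
  fixes F :: "nat set"
  assumes "finite F" "k \<le> card F"
  shows "\<exists>L\<subseteq>F. card L = k \<and> (\<forall>i\<in>L. \<forall>j\<in>F - L. i < j)"
  using assms(2)
proof (induction k)
  case (Suc k)
  then obtain L where L: "L \<subseteq> F" "card L = k" "\<forall>i\<in>L. \<forall>j\<in>F - L. i < j" by auto
  have fL: "finite L" using L(1) assms(1) finite_subset by blast
  have ne: "F - L \<noteq> {}" using Suc.prems L(2) fL by (metis Diff_eq_empty_iff card_mono not_less_eq_eq)
  define x where "x = Min (F - L)"
  have x: "x \<in> F - L" "\<And>j. j \<in> F - L \<Longrightarrow> x \<le> j"
    using ne assms(1) Min_in[of "F - L"] by (auto simp: x_def)
  show ?case
  proof (intro exI[of _ "insert x L"] conjI ballI)
    show "card (insert x L) = Suc k" using x(1) fL L(2) by simp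
    fix i j assume "i \<in> insert x L" "j \<in> F - insert x L"
    then show "i < j" using L(3) x(2)[of j] by (cases "i = x") (auto simp: le_less)
  qed (use L(1) x(1) in auto)
qed auto

text \<open>The gap consists of \<open>g\<close> successive elements of \<open>F\<close>, which
  itself may have holes: the positions of \<open>g\<close> elements strictly between
  \<open>i\<close> and \<open>j\<close> force the distance. If too few elements are left for a gap,
  \<open>R\<close> is empty and the separation is vacuous.\<close>

lemma split_with_gap:
  fixes F :: "nat set"
  assumes F: "finite F" "card F \<le> 2 * k"
  shows "\<exists>L R. L \<subseteq> F \<and> R \<subseteq> F \<and> L \<inter> R = {} \<and> card L \<le> k \<and> card R \<le> k \<and>
    card (F - (L \<union> R)) \<le> g \<and> (\<forall>i\<in>L. \<forall>j\<in>R. i + g \<le> j)"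
proof (cases "card F \<le> k")
  case True
  then show ?thesis by (intro exI[of _ F] exI[of _ "{}"]) auto
next
  case False
  then obtain L where L: "L \<subseteq> F" "card L = k" "\<forall>i\<in>L. \<forall>j\<in>F - L. i < j"
    using initial_segment_exists[OF F(1), of k] by auto
  have fL: "finite L" using L(1) F finite_subset by blast
  have cF: "card (F - L) \<le> k" using card_Diff_subset[OF fL L(1)] F(2) L(2) by simp
  show ?thesis
  proof (cases "card (F - L) \<le> g")
    case True
    then show ?thesis using L by (intro exI[of _ L] exI[of _ "{}"]) auto
  next
    case False
    then obtain G where G: "G \<subseteq> F - L" "card G = g" "\<forall>i\<in>G. \<forall>j\<in>F - L - G. i < j"
      using initial_segment_exists[of "F - L" g] F(1) by auto
    have "i + g \<le> j" if ij: "i \<in> L" "j \<in> F - L - G" for i j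
    proof -
      have "G \<subseteq> {i<..<j}" using G ij L(3) by auto
      then have "card G \<le> card {i<..<j}" by (intro card_mono) auto
      moreover have "i < j" using L(3) ij by auto
      ultimately show ?thesis using G(2) by simp
    qed
    moreover have "card (F - L - G) \<le> k" using cF F(1) card_mono[of "F - L" "F - L - G"] by auto
    moreover have "F - (L \<union> (F - L - G)) = G" using G(1) L(1) by auto
    ultimately show ?thesis using L G(2) by (intro exI[of _ L] exI[of _ "F - L - G"]) auto
  qed
qed

section \<open>Dyadic elimination of gaps\<close>

text \<open>A single row after truncation, so that the bound \<open>B\<close> holds at every point;
  \<open>V\<close> stands for \<open>v^2\<close>. The second moment bound is required for all finite
  index sets because the sets met later have holes.\<close>

locale mixing_row = prob_space M for M :: "'a measure" +
  fixes Y :: "nat \<Rightarrow> 'a \<Rightarrow> real" and B c V :: real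
  assumes Y_measurable: "i \<ge> 1 \<Longrightarrow> Y i \<in> borel_measurable M"
    and Y_bound: "\<bar>Y i \<omega>\<bar> \<le> B"
    and B_pos: "B > 0"
    and c_pos: "c > 0"
    and Y_centered: "i \<ge> 1 \<Longrightarrow> expectation (Y i) = 0"
    and Y_mixing: "\<lbrakk>j \<ge> 1; k \<ge> 1; A \<in> gen_sigma M Y {1..j}; A' \<in> gen_sigma M Y {k + j..}\<rbrakk>
      \<Longrightarrow> \<bar>prob (A \<inter> A') - prob A * prob A'\<bar> \<le> exp (- 2 * c * real k)"
    and V_nonneg: "V \<ge> 0"
    and second_moment_le: "\<lbrakk>finite F; F \<subseteq> {1..}\<rbrakk> \<Longrightarrow> expectation (\<lambda>\<omega>. (\<Sum>i\<in>F. Y i \<omega>)\<^sup>2) \<le> V * real (card F)"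
begin

definition S :: "nat set \<Rightarrow> 'a \<Rightarrow> real" where "S F \<omega> = (\<Sum>i\<in>F. Y i \<omega>)"

definition row_algebra :: "nat set \<Rightarrow> 'a measure" where
  "row_algebra I = sigma (space M) (\<Union>i\<in>I. {Y i -` B \<inter> space M | B. B \<in> sets borel})"

lemma space_row_algebra: "space (row_algebra I) = space M"
  by (simp add: row_algebra_def space_measure_of_conv)

lemma sets_row_algebra: "sets (row_algebra I) = gen_sigma M Y I"
  unfolding row_algebra_def gen_sigma_def by (rule sets_measure_of) auto

lemma subalgebra_row_algebra:
  assumes "I \<subseteq> {1..}" shows "subalgebra M (row_algebra I)"
proof -
  have "gen_sigma M Y I \<subseteq> sets M"
    unfolding gen_sigma_def
    by (rule sets.sigma_sets_subset) (use assms Y_measurable in \<open>auto intro!: measurable_sets\<close>)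
  then show ?thesis by (simp add: subalgebra_def space_row_algebra sets_row_algebra)
qed

lemma Y_measurable_row_algebra:
  assumes "i \<in> I" shows "Y i \<in> borel_measurable (row_algebra I)"
proof (rule measurableI)
  fix A :: "real set" assume "A \<in> sets borel"
  then show "Y i -` A \<inter> space (row_algebra I) \<in> sets (row_algebra I)"
    unfolding sets_row_algebra space_row_algebra gen_sigma_def
    using assms by (intro sigma_sets.Basic) auto
qed simp

lemma S_measurable_row_algebra: "F \<subseteq> I \<Longrightarrow> S F \<in> borel_measurable (row_algebra I)"
  unfolding S_def by (intro borel_measurable_sum Y_measurable_row_algebra) auto

lemma S_measurable: "F \<subseteq> {1..} \<Longrightarrow> S F \<in> borel_measurable M"
  unfolding S_def by (intro borel_measurable_sum Y_measurable) auto

lemma S_bound: "\<bar>S F \<omega>\<bar> \<le> B * real (card F)"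
proof -
  have "\<bar>S F \<omega>\<bar> \<le> (\<Sum>i\<in>F. \<bar>Y i \<omega>\<bar>)" unfolding S_def by (rule sum_abs)
  also have "\<dots> \<le> real (card F) * B" by (rule sum_bounded_above) (rule Y_bound)
  finally show ?thesis by (simp add: mult.commute)
qed

lemma mult_S_bound: "\<bar>t * S F \<omega>\<bar> \<le> \<bar>t\<bar> * B * real (card F)"
  using mult_left_mono[OF S_bound[of F \<omega>], of "\<bar>t\<bar>"] by (simp add: abs_mult mult.assoc)

lemma mult_S_measurable: "F \<subseteq> {1..} \<Longrightarrow> (\<lambda>\<omega>. t * S F \<omega>) \<in> borel_measurable M"
  using S_measurable by measurable

lemma integrable_Y: "i \<ge> 1 \<Longrightarrow> integrable M (Y i)"
  by (rule integrable_const_bound[where B=B]) (use Y_measurable Y_bound in auto)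

lemma expectation_S: "F \<subseteq> {1..} \<Longrightarrow> expectation (S F) = 0"
  unfolding S_def
  by (subst Bochner_Integration.integral_sum) (auto intro!: integrable_Y sum.neutral Y_centered)

lemma expectation_mult_S: "F \<subseteq> {1..} \<Longrightarrow> expectation (\<lambda>\<omega>. t * S F \<omega>) = 0"
  by (simp add: expectation_S)

lemma S_union: "\<lbrakk>finite F; finite G; F \<inter> G = {}\<rbrakk> \<Longrightarrow> S (F \<union> G) \<omega> = S F \<omega> + S G \<omega>"
  unfolding S_def by (rule sum.union_disjoint)

lemma S_empty: "S {} \<omega> = 0" by (simp add: S_def)

lemma log_laplace_S_empty: "log_laplace (\<lambda>\<omega>. t * S {} \<omega>) = 0"
  by (simp add: S_empty log_laplace_def prob_space)

lemma integrable_S_mult: "\<lbrakk>F \<subseteq> {1..}; G \<subseteq> {1..}\<rbrakk> \<Longrightarrow> integrable M (\<lambda>\<omega>. S F \<omega> * S G \<omega>)"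
proof (rule integrable_const_bound[where B="(B * real (card F)) * (B * real (card G))"])
  assume a: "F \<subseteq> {1..}" "G \<subseteq> {1..}"
  show "(\<lambda>\<omega>. S F \<omega> * S G \<omega>) \<in> borel_measurable M" using S_measurable a by measurable
  show "AE \<omega> in M. norm (S F \<omega> * S G \<omega>) \<le> (B * real (card F)) * (B * real (card G))"
    using S_bound B_pos by (auto simp: abs_mult intro!: mult_mono)
qed

lemma integrable_S_square: "F \<subseteq> {1..} \<Longrightarrow> integrable M (\<lambda>\<omega>. (S F \<omega>)\<^sup>2)"
  using integrable_S_mult[of F F] by (simp add: power2_eq_square)

lemma S_second_moment_le:
  "\<lbrakk>finite F; F \<subseteq> {1..}\<rbrakk> \<Longrightarrow> expectation (\<lambda>\<omega>. (S F \<omega>)\<^sup>2) \<le> V * real (card F)"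
  unfolding S_def by (rule second_moment_le)

text \<open>The set \<open>F\<close> lies in the past \<open>{1..Max F}\<close> and \<open>G\<close>
  in the future \<open>{g + Max F..}\<close>, so the shape of either is irrelevant. The functions
  \<open>f\<close> and \<open>h\<close> are exponentials for Laplace transforms and identities for
  second moments.\<close>

lemma separated_covariance:
  assumes F: "finite F" "F \<subseteq> {1..}" "F \<noteq> {}" and G: "G \<subseteq> {1..}"
    and g: "g \<ge> 1" "\<And>i j. i \<in> F \<Longrightarrow> j \<in> G \<Longrightarrow> i + g \<le> j"
    and f: "f \<in> borel_measurable borel" "\<And>\<omega>. \<bar>f (S F \<omega>)\<bar> \<le> x"
    and h: "h \<in> borel_measurable borel" "\<And>\<omega>. \<bar>h (S G \<omega>)\<bar> \<le> y"
  shows "\<bar>expectation (\<lambda>\<omega>. f (S F \<omega>) * h (S G \<omega>)) - expectation (\<lambda>\<omega>. f (S F \<omega>)) * expectation (\<lambda>\<omega>. h (S G \<omega>))\<bar>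
    \<le> 4 * exp (- 2 * c * real g) * x * y"
proof (rule cov_le_mixing[where F="row_algebra {1..Max F}" and G="row_algebra {g + Max F..}"])
  show "subalgebra M (row_algebra {1..Max F})" "subalgebra M (row_algebra {g + Max F..})"
    using g(1) by (auto intro!: subalgebra_row_algebra)
  have "Max F \<ge> 1" using F(2) Max_in[OF F(1,3)] by auto
  then show "\<bar>prob (A \<inter> A') - prob A * prob A'\<bar> \<le> exp (- 2 * c * real g)"
    if "A \<in> sets (row_algebra {1..Max F})" "A' \<in> sets (row_algebra {g + Max F..})" for A A'
    using that g(1) Y_mixing unfolding sets_row_algebra by blast
  have "F \<subseteq> {1..Max F}" using F by auto
  then show "(\<lambda>\<omega>. f (S F \<omega>)) \<in> borel_measurable (row_algebra {1..Max F})"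
    using f(1) S_measurable_row_algebra by (intro measurable_compose[OF _ f(1)])
  have "G \<subseteq> {g + Max F..}" using g(2)[OF Max_in[OF F(1,3)]] by (auto simp: add.commute)
  then show "(\<lambda>\<omega>. h (S G \<omega>)) \<in> borel_measurable (row_algebra {g + Max F..})"
    by (intro measurable_compose[OF _ h(1)] S_measurable_row_algebra)
qed (use f h in auto)

text \<open>The sup norms of the two exponentials multiply to at most \<open>exp x\<close>, and the
  gap condition turns \<open>4 * exp (x - 2 * c * g)\<close> into
  \<open>4 * exp (- 3 * \<Lambda>)\<close>. As both Laplace transforms are at least 1, the relative
  error is no larger, and the logarithm at most doubles it.\<close>

lemma log_laplace_split:
  assumes F: "finite F" "F \<subseteq> {1..}" and G: "finite G" "G \<subseteq> {1..}" and FG: "F \<inter> G = {}"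
    and g: "g \<ge> 1" "\<And>i j. i \<in> F \<Longrightarrow> j \<in> G \<Longrightarrow> i + g \<le> j"
    and x: "\<bar>t\<bar> * B * real (card F + card G) \<le> x" and xg: "x + 3 * \<Lambda> \<le> 2 * c * real g" and \<Lambda>: "\<Lambda> \<ge> 1"
  shows "\<bar>log_laplace (\<lambda>\<omega>. t * S (F \<union> G) \<omega>) - log_laplace (\<lambda>\<omega>. t * S F \<omega>) - log_laplace (\<lambda>\<omega>. t * S G \<omega>)\<bar>
    \<le> 8 * exp (- 3 * \<Lambda>)"
proof (cases "F = {} \<or> G = {}")
  case True
  then show ?thesis by (auto simp: log_laplace_S_empty)
next
  case False
  let ?E = "\<lambda>A. expectation (\<lambda>\<omega>. exp (t * S A \<omega>))"
  have u: "\<bar>exp (t * S A \<omega>)\<bar> \<le> exp (\<bar>t\<bar> * B * real (card A))" for A \<omega>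
    using mult_S_bound[of t A \<omega>] by (auto simp: abs_le_iff)
  define e where "e = expectation (\<lambda>\<omega>. exp (t * S F \<omega>) * exp (t * S G \<omega>)) - ?E F * ?E G"
  have e: "\<bar>e\<bar> \<le> 4 * exp (- 2 * c * real g) * exp (\<bar>t\<bar> * B * real (card F)) * exp (\<bar>t\<bar> * B * real (card G))"
    unfolding e_def
    by (rule separated_covariance[OF F _ G(2) g]) (use False u in auto)
  also have "\<dots> = 4 * exp (\<bar>t\<bar> * B * real (card F + card G) - 2 * c * real g)"
    by (simp add: exp_add[symmetric] algebra_simps)
  also have "\<dots> \<le> 4 * exp (- 3 * \<Lambda>)" using x xg by simp
  finally have e4: "\<bar>e\<bar> \<le> 4 * exp (- 3 * \<Lambda>)" .
  have E: "?E (F \<union> G) = ?E F * ?E G + e"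
    unfolding e_def by (simp add: S_union[OF F(1) G(1) FG] distrib_left exp_add)
  have EF: "1 \<le> ?E F" and EG: "1 \<le> ?E G"
    using expectation_exp_ge_1[OF mult_S_measurable mult_S_bound expectation_mult_S] F G by auto
  define p where "p = ?E F * ?E G"
  have p: "p \<ge> 1" using mult_mono[OF EF EG] by (simp add: p_def)
  have "\<bar>e / p\<bar> \<le> \<bar>e\<bar>" using p by (simp add: divide_le_eq mult_ge1_I mult_left_le_one_le mult_le_cancel_left1)
  then have ep: "\<bar>e / p\<bar> \<le> 4 * exp (- 3 * \<Lambda>)" using e4 by linarith
  \<comment> \<open>Here \<open>\<Lambda> \<ge> 1\<close> and \<open>exp 1 \<ge> 2\<close> keep the
    relative error within 1/2, away from the singularity of the logarithm.\<close>
  have half: "4 * exp (- 3 * \<Lambda>) \<le> 1 / 2"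
  proof -
    have "exp (3 * \<Lambda>) \<ge> exp 1 ^ 3" using \<Lambda> by (simp add: exp_of_nat_mult[symmetric])
    moreover have "exp 1 ^ 3 \<ge> (2::real) ^ 3" using exp_ge_add_one_self[of 1] by (intro power_mono) auto
    ultimately have "exp (3 * \<Lambda>) \<ge> 8" by simp
    then show ?thesis by (simp add: exp_minus field_simps)
  qed
  have "\<bar>ln (1 + e / p)\<bar> \<le> 2 * \<bar>e / p\<bar>"
  proof -
    have h: "\<bar>e / p\<bar> \<le> 1 / 2" using ep half by linarith
    have "\<bar>ln (1 + e / p) - e / p\<bar> \<le> 2 * (e / p)\<^sup>2" by (rule abs_ln_one_plus_x_minus_x_bound[OF h])
    also have "\<dots> = 2 * (\<bar>e / p\<bar> * \<bar>e / p\<bar>)" by (simp add: power2_eq_square abs_mult_self)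
    also have "\<dots> \<le> 2 * (1 / 2 * \<bar>e / p\<bar>)" using h by (intro mult_left_mono mult_right_mono) auto
    finally show ?thesis by linarith
  qed
  moreover have "ln (?E (F \<union> G)) = ln (?E F) + ln (?E G) + ln (1 + e / p)"
  proof -
    have "?E (F \<union> G) = p * (1 + e / p)" unfolding E p_def[symmetric] using p by (simp add: field_simps)
    moreover have "1 + e / p > 0" using ep half unfolding abs_le_iff by linarith
    ultimately show ?thesis using p EF EG by (simp add: ln_mult p_def)
  qed
  ultimately show ?thesis using ep by (simp add: log_laplace_def)
qed

text \<open>The additive counterpart of the factorisation; it links the sum of block second moments,
  which the expansion produces, to the second moment of the sum over all kept indices.\<close>

lemma second_moment_split:
  assumes F: "finite F" "F \<subseteq> {1..}" and G: "finite G" "G \<subseteq> {1..}" and FG: "F \<inter> G = {}"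
    and g: "g \<ge> 1" "\<And>i j. i \<in> F \<Longrightarrow> j \<in> G \<Longrightarrow> i + g \<le> j"
  shows "\<bar>expectation (\<lambda>\<omega>. (S (F \<union> G) \<omega>)\<^sup>2) - expectation (\<lambda>\<omega>. (S F \<omega>)\<^sup>2) - expectation (\<lambda>\<omega>. (S G \<omega>)\<^sup>2)\<bar>
    \<le> 8 * exp (- 2 * c * real g) * B\<^sup>2 * (real (card F) * real (card G))"
proof (cases "F = {} \<or> G = {}")
  case True
  then show ?thesis by (auto simp: S_empty)
next
  case False
  have "\<bar>expectation (\<lambda>\<omega>. S F \<omega> * S G \<omega>) - expectation (S F) * expectation (S G)\<bar>
    \<le> 4 * exp (- 2 * c * real g) * (B * real (card F)) * (B * real (card G))"
    using separated_covariance[OF F _ G(2) g, of "\<lambda>x. x" _ "\<lambda>x. x"] False S_bound by auto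
  then have c: "\<bar>expectation (\<lambda>\<omega>. S F \<omega> * S G \<omega>)\<bar> \<le> 4 * exp (- 2 * c * real g) * (B * real (card F)) * (B * real (card G))"
    using expectation_S F by simp
  have "expectation (\<lambda>\<omega>. (S (F \<union> G) \<omega>)\<^sup>2) = expectation (\<lambda>\<omega>. (S F \<omega>)\<^sup>2 + (S G \<omega>)\<^sup>2 + 2 * (S F \<omega> * S G \<omega>))"
    by (simp add: S_union[OF F(1) G(1) FG] power2_sum mult.assoc)
  also have "\<dots> = expectation (\<lambda>\<omega>. (S F \<omega>)\<^sup>2) + expectation (\<lambda>\<omega>. (S G \<omega>)\<^sup>2) + 2 * expectation (\<lambda>\<omega>. S F \<omega> * S G \<omega>)"
    using integrable_S_square[OF F(2)] integrable_S_square[OF G(2)] integrable_S_mult[OF F(2) G(2)] by simp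
  finally show ?thesis using c by (simp add: power2_eq_square abs_mult algebra_simps)
qed

lemma block_log_laplace:
  assumes F: "F \<subseteq> {1..}" and \<eta>: "\<bar>t\<bar> * B * real (card F) \<le> \<eta>" "\<eta> \<le> 1 / 2"
  shows "\<bar>log_laplace (\<lambda>\<omega>. t * S F \<omega>) - t\<^sup>2 * expectation (\<lambda>\<omega>. (S F \<omega>)\<^sup>2) / 2\<bar>
    \<le> 3 * \<eta> * (t\<^sup>2 * expectation (\<lambda>\<omega>. (S F \<omega>)\<^sup>2))"
proof -
  have "\<bar>t * S F \<omega>\<bar> \<le> \<eta>" for \<omega> using mult_S_bound \<eta>(1) by (rule order_trans)
  from log_laplace_second_order[OF mult_S_measurable[OF F] this expectation_mult_S[OF F] \<eta>(2)]
  show ?thesis by (simp add: power_mult_distrib)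
qed

text \<open>Chosen so that \<open>(x + 3 * \<Lambda>) / (2 * c)\<close>, rounded up, is at most
  \<open>gap_const * (x + \<Lambda>)\<close>; the summand 1 pays for the rounding, as
  \<open>\<Lambda> \<ge> 1\<close>.\<close>

definition gap_const :: real where "gap_const = 3 / (2 * c) + 1"

text \<open>At depth \<open>j\<close> a set of at most \<open>m 2^j\<close> indices is cut in the middle
  by a gap long enough to beat the sup norm \<open>\<tau> m 2^j\<close> of the exponent on both halves; \<open>q\<close> is the
  sum of the second moments over the remaining blocks.\<close>

lemma dyadic_elimination:
  assumes \<tau>: "0 \<le> \<tau>" "\<tau> * real m \<le> \<eta>" "\<eta> \<le> 1 / 2" and \<Lambda>: "\<Lambda> \<ge> 1"
  shows "\<lbrakk>finite F; F \<subseteq> {1..}; card F \<le> m * 2 ^ j; card F \<le> N\<rbrakk> \<Longrightarrow>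
    \<exists>K q. K \<subseteq> F \<and> 0 \<le> q \<and> q \<le> V * real (card F)
      \<and> real (card (F - K)) \<le> gap_const * (\<tau> * real m * 2 ^ j * real j + (2 ^ j - 1) * \<Lambda>)
      \<and> (\<forall>t. \<bar>t\<bar> * B \<le> \<tau> \<longrightarrow> \<bar>log_laplace (\<lambda>\<omega>. t * S K \<omega>) - t\<^sup>2 * q / 2\<bar>
            \<le> 3 * \<eta> * (t\<^sup>2 * q) + (2 ^ j - 1) * (8 * exp (- 3 * \<Lambda>)))
      \<and> \<bar>expectation (\<lambda>\<omega>. (S K \<omega>)\<^sup>2) - q\<bar> \<le> (2 ^ j - 1) * (8 * exp (- 3 * \<Lambda>) * B\<^sup>2 * (real N)\<^sup>2)"
proof (induction j arbitrary: F)
  case 0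
  show ?case
  proof (intro exI[of _ F] exI[of _ "expectation (\<lambda>\<omega>. (S F \<omega>)\<^sup>2)"] conjI allI impI)
    show "expectation (\<lambda>\<omega>. (S F \<omega>)\<^sup>2) \<le> V * real (card F)" by (rule S_second_moment_le[OF 0(1,2)])
    fix t assume t: "\<bar>t\<bar> * B \<le> \<tau>"
    have "\<bar>t\<bar> * B * real (card F) \<le> \<tau> * real m"
      using t \<tau> B_pos 0(3) by (intro mult_mono) auto
    then have "\<bar>t\<bar> * B * real (card F) \<le> \<eta>" using \<tau>(2) by linarith
    from block_log_laplace[OF 0(2) this \<tau>(3)]
    show "\<bar>log_laplace (\<lambda>\<omega>. t * S F \<omega>) - t\<^sup>2 * expectation (\<lambda>\<omega>. (S F \<omega>)\<^sup>2) / 2\<bar>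
      \<le> 3 * \<eta> * (t\<^sup>2 * expectation (\<lambda>\<omega>. (S F \<omega>)\<^sup>2)) + (2 ^ 0 - 1) * (8 * exp (- 3 * \<Lambda>))" by simp
  qed auto
next
  case (Suc j)
  define x where "x = \<tau> * real m * 2 ^ Suc j"
  have x0: "x \<ge> 0" using \<tau> by (simp add: x_def)
  \<comment> \<open>The least integer gap that beats the exponent \<open>x\<close> on both halves
    together with a surplus \<open>3 * \<Lambda>\<close>, which becomes the error of the
    cut.\<close>
  define g where "g = nat \<lceil>(x + 3 * \<Lambda>) / (2 * c)\<rceil>"
  have pos: "(x + 3 * \<Lambda>) / (2 * c) > 0" using x0 \<Lambda> c_pos by simp
  have g1: "g \<ge> 1" using pos unfolding g_def by linarith
  have gc: "x + 3 * \<Lambda> \<le> 2 * c * real g"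
  proof -
    have "(x + 3 * \<Lambda>) / (2 * c) \<le> real g" unfolding g_def by (rule real_nat_ceiling_ge)
    then show ?thesis using c_pos by (simp add: field_simps)
  qed
  have gle: "real g \<le> gap_const * (x + \<Lambda>)"
  proof -
    have "real g \<le> (x + 3 * \<Lambda>) / (2 * c) + 1" unfolding g_def using pos by linarith
    also have "(x + 3 * \<Lambda>) / (2 * c) \<le> (3 * (x + \<Lambda>)) / (2 * c)"
      using x0 c_pos by (intro divide_right_mono) auto
    also have "\<dots> = 3 / (2 * c) * (x + \<Lambda>)" by simp
    finally show ?thesis using x0 \<Lambda> by (simp add: gap_const_def algebra_simps)
  qed
  have F2: "card F \<le> 2 * (m * 2 ^ j)" using Suc.prems(3) by simp
  obtain L R where LR: "L \<subseteq> F" "R \<subseteq> F" "L \<inter> R = {}" "card L \<le> m * 2 ^ j" "card R \<le> m * 2 ^ j"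
    "card (F - (L \<union> R)) \<le> g" "\<forall>i\<in>L. \<forall>j\<in>R. i + g \<le> j"
    using split_with_gap[OF Suc.prems(1) F2, of g] by blast
  have fin: "finite L" "finite R" using finite_subset[OF _ Suc.prems(1)] LR(1,2) by auto
  have cLR: "card L + card R \<le> card F"
    using card_mono[OF Suc.prems(1), of "L \<union> R"] LR(1,2) card_Un_disjoint[OF fin LR(3)] by simp
  have cL: "card L \<le> N" "card R \<le> N" using cLR Suc.prems(4) by auto
  have sL: "L \<subseteq> {1..}" "R \<subseteq> {1..}" using LR Suc.prems(2) by auto
  define e d where e_def: "e = 8 * exp (- 3 * \<Lambda>)" and d_def: "d = 8 * exp (- 3 * \<Lambda>) * B\<^sup>2 * (real N)\<^sup>2"
  note IH = Suc.IH[folded e_def, folded d_def[folded e_def]]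
  obtain K1 q1 where 1: "K1 \<subseteq> L" "0 \<le> q1" "q1 \<le> V * real (card L)"
      "real (card (L - K1)) \<le> gap_const * (\<tau> * real m * 2 ^ j * real j + (2 ^ j - 1) * \<Lambda>)"
      "\<And>t. \<bar>t\<bar> * B \<le> \<tau> \<Longrightarrow> \<bar>log_laplace (\<lambda>\<omega>. t * S K1 \<omega>) - t\<^sup>2 * q1 / 2\<bar> \<le> 3 * \<eta> * (t\<^sup>2 * q1) + (2 ^ j - 1) * e"
      "\<bar>expectation (\<lambda>\<omega>. (S K1 \<omega>)\<^sup>2) - q1\<bar> \<le> (2 ^ j - 1) * d"
    using IH[OF fin(1) sL(1) LR(4) cL(1)] by blast
  obtain K2 q2 where 2: "K2 \<subseteq> R" "0 \<le> q2" "q2 \<le> V * real (card R)"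
      "real (card (R - K2)) \<le> gap_const * (\<tau> * real m * 2 ^ j * real j + (2 ^ j - 1) * \<Lambda>)"
      "\<And>t. \<bar>t\<bar> * B \<le> \<tau> \<Longrightarrow> \<bar>log_laplace (\<lambda>\<omega>. t * S K2 \<omega>) - t\<^sup>2 * q2 / 2\<bar> \<le> 3 * \<eta> * (t\<^sup>2 * q2) + (2 ^ j - 1) * e"
      "\<bar>expectation (\<lambda>\<omega>. (S K2 \<omega>)\<^sup>2) - q2\<bar> \<le> (2 ^ j - 1) * d"
    using IH[OF fin(2) sL(2) LR(5) cL(2)] by blast
  have finK: "finite K1" "finite K2" using finite_subset[OF 1(1) fin(1)] finite_subset[OF 2(1) fin(2)] by auto
  have cK: "card K1 \<le> card L" "card K2 \<le> card R" using 1(1) 2(1) fin by (auto intro: card_mono)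
  have sK: "K1 \<subseteq> {1..}" "K2 \<subseteq> {1..}" "K1 \<inter> K2 = {}" using 1(1) 2(1) sL LR(3) by blast+
  have gK: "i + g \<le> k" if "i \<in> K1" "k \<in> K2" for i k using LR(7) that 1(1) 2(1) by (meson subsetD)
  show ?case
    unfolding e_def[symmetric] d_def[folded e_def, symmetric]
  proof (intro exI[of _ "K1 \<union> K2"] exI[of _ "q1 + q2"] conjI allI impI)
    show "K1 \<union> K2 \<subseteq> F" "0 \<le> q1 + q2" using 1(1,2) 2(1,2) LR(1,2) by auto
    have "V * real (card L) + V * real (card R) = V * real (card L + card R)" by (simp add: algebra_simps)
    also have "\<dots> \<le> V * real (card F)" using cLR V_nonneg by (intro mult_left_mono) auto
    finally show "q1 + q2 \<le> V * real (card F)" using 1(3) 2(3) by linarith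
    show "real (card (F - (K1 \<union> K2))) \<le> gap_const * (\<tau> * real m * 2 ^ Suc j * real (Suc j) + (2 ^ Suc j - 1) * \<Lambda>)"
    proof -
      have "F - (K1 \<union> K2) \<subseteq> (F - (L \<union> R)) \<union> ((L - K1) \<union> (R - K2))" by auto
      then have "card (F - (K1 \<union> K2)) \<le> card ((F - (L \<union> R)) \<union> ((L - K1) \<union> (R - K2)))"
        using Suc.prems(1) fin by (intro card_mono) auto
      also have "\<dots> \<le> card (F - (L \<union> R)) + (card (L - K1) + card (R - K2))"
        by (meson add_left_mono card_Un_le order_trans)
      also have "\<dots> \<le> g + (card (L - K1) + card (R - K2))" using LR(6) by simp
      finally have "real (card (F - (K1 \<union> K2))) \<le> real g + (real (card (L - K1)) + real (card (R - K2)))"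
        by linarith
      \<comment> \<open>One gap plus twice the loss of a half: every level contributes the same
        multiple of \<open>\<tau> * m * 2 ^ Suc j\<close>, hence the factor \<open>Suc j\<close>,
        while \<open>\<Lambda>\<close> is paid once per cut, \<open>2 ^ Suc j - 1\<close>
        times.\<close>
      also have "\<dots> \<le> gap_const * (x + \<Lambda>) + 2 * (gap_const * (\<tau> * real m * 2 ^ j * real j + (2 ^ j - 1) * \<Lambda>))"
        using gle 1(4) 2(4) by linarith
      also have "\<dots> = gap_const * (\<tau> * real m * 2 ^ Suc j * real (Suc j) + (2 ^ Suc j - 1) * \<Lambda>)"
        unfolding x_def by (simp add: algebra_simps)
      finally show ?thesis .
    qed
    show "\<bar>log_laplace (\<lambda>\<omega>. t * S (K1 \<union> K2) \<omega>) - t\<^sup>2 * (q1 + q2) / 2\<bar> \<le> 3 * \<eta> * (t\<^sup>2 * (q1 + q2)) + (2 ^ Suc j - 1) * e"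
      if t: "\<bar>t\<bar> * B \<le> \<tau>" for t
    proof -
      have "card K1 + card K2 \<le> m * 2 ^ Suc j" using cK LR(4,5) by simp
      then have "real (card K1 + card K2) \<le> real m * 2 ^ Suc j"
        by (metis of_nat_le_iff of_nat_mult of_nat_numeral of_nat_power)
      then have "\<bar>t\<bar> * B * real (card K1 + card K2) \<le> \<tau> * (real m * 2 ^ Suc j)"
        using t \<tau> B_pos by (intro mult_mono) auto
      then have "\<bar>t\<bar> * B * real (card K1 + card K2) \<le> x" by (simp add: x_def mult.assoc)
      from log_laplace_split[OF finK(1) sK(1) finK(2) sK(2,3) g1 gK this gc \<Lambda>]
      have "\<bar>log_laplace (\<lambda>\<omega>. t * S (K1 \<union> K2) \<omega>) - t\<^sup>2 * (q1 + q2) / 2\<bar> \<le>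
        e + (3 * \<eta> * (t\<^sup>2 * q1) + (2 ^ j - 1) * e) + (3 * \<eta> * (t\<^sup>2 * q2) + (2 ^ j - 1) * e)"
        using 1(5)[OF t] 2(5)[OF t] unfolding distrib_left add_divide_distrib e_def[symmetric] by linarith
      then show ?thesis by (simp add: algebra_simps)
    qed
    show "\<bar>expectation (\<lambda>\<omega>. (S (K1 \<union> K2) \<omega>)\<^sup>2) - (q1 + q2)\<bar> \<le> (2 ^ Suc j - 1) * d"
    proof -
      have "8 * exp (- 2 * c * real g) * B\<^sup>2 * (real (card K1) * real (card K2)) \<le> d"
        unfolding d_def power2_eq_square[of "real N"]
        using gc x0 cK cL by (intro mult_mono) auto
      then have "\<bar>expectation (\<lambda>\<omega>. (S (K1 \<union> K2) \<omega>)\<^sup>2) - (q1 + q2)\<bar> \<le> d + (2 ^ j - 1) * d + (2 ^ j - 1) * d"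
        using second_moment_split[OF finK(1) sK(1) finK(2) sK(2,3) g1 gK] 1(6) 2(6) by linarith
      then show ?thesis by (simp add: algebra_simps)
    qed
  qed
qed

end

section \<open>A Bernstein bound\<close>

lemma exp_minus_3_le:
  assumes "ln (real N) \<le> \<Lambda>" "real A \<le> real N" "A \<ge> 1"
  shows "exp (- 3 * \<Lambda>) \<le> 1 / real A ^ 3"
proof -
  have "ln (real A) \<le> ln (real N)" using assms by (intro ln_mono) auto
  then have "ln (real A) \<le> \<Lambda>" using assms(1) by (rule order_trans)
  then have "exp (- 3 * \<Lambda>) \<le> exp (- 3 * ln (real A))" by simp
  also have "\<dots> = 1 / real A ^ 3"
    using assms(3) exp_of_nat_mult[of 3 "ln (real A)"] by (simp add: exp_minus field_simps)
  finally show ?thesis .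
qed

lemma sqrt_2_power_square: "(sqrt 2 ^ i)\<^sup>2 = (2::real) ^ i"
proof -
  have "(sqrt 2 ^ i)\<^sup>2 = ((sqrt 2)\<^sup>2) ^ i" by (simp only: power_mult[symmetric] mult.commute)
  then show ?thesis by simp
qed

text \<open>Bounds the number of dyadic levels: \<open>ln 2 \<ge> 1 / 2\<close> gives
  \<open>i \<le> 2 * \<Lambda>\<close>, and \<open>\<Lambda> \<ge> 1\<close> pays for the
  successor.\<close>

lemma exponent_le_of_power_two_le:
  assumes "2 ^ i \<le> real N" "ln (real N) \<le> \<Lambda>" "\<Lambda> \<ge> 1"
  shows "real (Suc i) \<le> 3 * \<Lambda>"
proof -
  have "real i * ln 2 = ln (2 ^ i)" by (simp add: ln_realpow)
  also have "\<dots> \<le> ln (real N)" using assms(1) by (intro ln_mono) auto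
  finally have "real i * ln 2 \<le> \<Lambda>" using assms(2) by linarith
  moreover have "real i * (1 / 2) \<le> real i * ln 2" using ln2_ge_two_thirds by (intro mult_left_mono) auto
  ultimately show ?thesis using assms(3) by simp
qed

context mixing_row
begin

lemma gap_const_ge_1: "gap_const \<ge> 1"
  using c_pos by (simp add: gap_const_def)

text \<open>The parameters of the tree are fixed: \<open>m\<close> is the largest block length with
  \<open>\<tau> * m \<le> \<eta>\<close>, and \<open>j\<close> the least depth that reaches
  \<open>card F\<close>. There are then of order \<open>card F * \<tau> / \<eta>\<close> blocks and
  of order \<open>\<Lambda>\<close> levels, so a proportion of order
  \<open>\<tau> * \<Lambda> / \<eta>\<close> is removed.\<close>

lemma block_elimination:
  assumes F: "finite F" "F \<subseteq> {1..}" "card F \<le> N"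
    and \<tau>: "0 < \<tau>" "\<tau> \<le> \<eta>" "\<eta> \<le> 1 / 2" and \<Lambda>: "\<Lambda> \<ge> 1" "ln (real N) \<le> \<Lambda>"
  shows "\<exists>K q. K \<subseteq> F \<and> 0 \<le> q \<and> q \<le> V * real (card F)
      \<and> real (card (F - K)) \<le> 10 * gap_const * real (card F) * (\<tau> * \<Lambda> / \<eta>)
      \<and> (\<forall>t. \<bar>t\<bar> * B \<le> \<tau> \<longrightarrow> \<bar>log_laplace (\<lambda>\<omega>. t * S K \<omega>) - t\<^sup>2 * q / 2\<bar>
            \<le> 3 * \<eta> * (t\<^sup>2 * q) + 16 * real (card F) * exp (- 3 * \<Lambda>))
      \<and> \<bar>expectation (\<lambda>\<omega>. (S K \<omega>)\<^sup>2) - q\<bar> \<le> 16 * real (card F) * exp (- 3 * \<Lambda>) * (B\<^sup>2 * (real N)\<^sup>2)"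
proof -
  let ?A = "real (card F)"
  define m where "m = nat \<lfloor>\<eta> / \<tau>\<rfloor>"
  have \<eta>: "\<eta> > 0" using \<tau> by linarith
  have r1: "\<eta> / \<tau> \<ge> 1" using \<tau> by (simp add: field_simps)
  have m1: "m \<ge> 1" using r1 unfolding m_def by linarith
  have m2: "real m \<le> \<eta> / \<tau>" "\<eta> / \<tau> \<le> 2 * real m"
  proof -
    have "real m = of_int \<lfloor>\<eta> / \<tau>\<rfloor>" "\<lfloor>\<eta> / \<tau>\<rfloor> \<ge> 1" using r1 unfolding m_def by auto
    then show "real m \<le> \<eta> / \<tau>" "\<eta> / \<tau> \<le> 2 * real m" by linarith+
  qed
  have tm: "\<tau> * real m \<le> \<eta>" using m2(1) \<tau> by (simp add: field_simps)
  have mt: "1 \<le> 2 * real m * \<tau> / \<eta>" using m2(2) \<tau> \<eta> by (simp add: field_simps)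
  define j where "j = (LEAST j. card F \<le> m * 2 ^ j)"
  have "card F \<le> m * 2 ^ card F"
    using less_exp[of "card F"] m1 by (metis less_imp_le mult_le_mono nat_mult_1 order_trans)
  then have j: "card F \<le> m * 2 ^ j" unfolding j_def by (rule LeastI)
  have pow: "(2 ^ j - 1) \<le> 2 * ?A \<and> gap_const * (\<tau> * real m * 2 ^ j * real j + (2 ^ j - 1) * \<Lambda>) \<le>
    10 * gap_const * ?A * (\<tau> * \<Lambda> / \<eta>)"
  proof (cases j)
    case 0
    then show ?thesis using gap_const_ge_1 \<tau> \<Lambda> \<eta> by simp
  next
    case (Suc i)
    have "\<not> card F \<le> m * 2 ^ i" using not_less_Least[of i "\<lambda>j. card F \<le> m * 2 ^ j"] Suc unfolding j_def by auto
    then have i: "m * 2 ^ i \<le> card F" by simp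
    then have ir: "real m * 2 ^ i \<le> ?A" by (metis of_nat_le_iff of_nat_mult of_nat_numeral of_nat_power)
    have A0: "?A \<ge> 0" by simp
    have "1 * 2 ^ i \<le> real m * 2 ^ i" using m1 by (intro mult_right_mono) auto
    then have iA: "2 ^ i \<le> ?A" using ir by linarith
    have jL: "real j \<le> 3 * \<Lambda>" unfolding Suc
      by (rule exponent_le_of_power_two_le[OF _ \<Lambda>(2,1)]) (use iA F(3) in linarith)
    have mj: "real m * 2 ^ j \<le> 2 * ?A" using ir Suc by simp
    \<comment> \<open>Since \<open>m\<close> is at least half of \<open>\<eta> / \<tau>\<close>, the
      bound \<open>m * 2 ^ j \<le> 2 * card F\<close>, from minimality of \<open>j\<close>, limits
      the number of blocks.\<close>
    have j4: "2 ^ j \<le> 4 * ?A * (\<tau> / \<eta>)"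
    proof -
      have "2 ^ j * 1 \<le> 2 ^ j * (2 * real m * \<tau> / \<eta>)" using mt by (intro mult_left_mono) auto
      also have "\<dots> = 2 * (real m * 2 ^ j) * (\<tau> / \<eta>)" by simp
      also have "\<dots> \<le> 2 * (2 * ?A) * (\<tau> / \<eta>)" using mj \<tau> \<eta> by (intro mult_right_mono mult_left_mono) auto
      finally show ?thesis by simp
    qed
    have "\<tau> * real m * 2 ^ j * real j = \<tau> * ((real m * 2 ^ j) * real j)" by simp
    also have "\<dots> \<le> \<tau> * ((2 * ?A) * (3 * \<Lambda>))" using mult_mono[OF mj jL] \<tau> by (intro mult_left_mono) auto
    also have "\<dots> = 6 * ?A * (\<tau> * \<Lambda>)" by simp
    \<comment> \<open>Weakened by \<open>1 / \<eta> \<ge> 1\<close> only to have the same shape as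
      the contribution of the terms \<open>\<Lambda>\<close>; 6 + 4 gives the constant 10.\<close>
    also have "\<dots> \<le> 6 * ?A * (\<tau> * \<Lambda> / \<eta>)"
    proof (rule mult_left_mono)
      have "\<tau> * \<Lambda> * \<eta> \<le> \<tau> * \<Lambda> * 1" using \<tau> \<Lambda> by (intro mult_left_mono) auto
      then show "\<tau> * \<Lambda> \<le> \<tau> * \<Lambda> / \<eta>" using \<eta> by (simp add: field_simps)
    qed simp
    finally have a1: "\<tau> * real m * 2 ^ j * real j \<le> 6 * ?A * (\<tau> * \<Lambda> / \<eta>)" .
    have "(2 ^ j - 1) * \<Lambda> \<le> (4 * ?A * (\<tau> / \<eta>)) * \<Lambda>" using j4 \<Lambda> by (intro mult_right_mono) auto
    also have "\<dots> = 4 * ?A * (\<tau> * \<Lambda> / \<eta>)" by simp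
    finally have a2: "(2 ^ j - 1) * \<Lambda> \<le> 4 * ?A * (\<tau> * \<Lambda> / \<eta>)" .
    have "6 * ?A * z + 4 * ?A * z = 10 * ?A * z" for z by simp
    then have "\<tau> * real m * 2 ^ j * real j + (2 ^ j - 1) * \<Lambda> \<le> 10 * ?A * (\<tau> * \<Lambda> / \<eta>)"
      using add_mono[OF a1 a2] by metis
    then have "gap_const * (\<tau> * real m * 2 ^ j * real j + (2 ^ j - 1) * \<Lambda>) \<le> gap_const * (10 * ?A * (\<tau> * \<Lambda> / \<eta>))"
      using gap_const_ge_1 by (intro mult_left_mono) auto
    moreover have "2 ^ j - 1 \<le> 2 * ?A" using iA unfolding Suc power_Suc by linarith
    ultimately show ?thesis by (simp only: mult.assoc mult.left_commute[of gap_const])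
  qed
  obtain K q where K: "K \<subseteq> F" "0 \<le> q" "q \<le> V * ?A"
      "real (card (F - K)) \<le> gap_const * (\<tau> * real m * 2 ^ j * real j + (2 ^ j - 1) * \<Lambda>)"
      "\<And>t. \<bar>t\<bar> * B \<le> \<tau> \<Longrightarrow> \<bar>log_laplace (\<lambda>\<omega>. t * S K \<omega>) - t\<^sup>2 * q / 2\<bar>
            \<le> 3 * \<eta> * (t\<^sup>2 * q) + (2 ^ j - 1) * (8 * exp (- 3 * \<Lambda>))"
      "\<bar>expectation (\<lambda>\<omega>. (S K \<omega>)\<^sup>2) - q\<bar> \<le> (2 ^ j - 1) * (8 * exp (- 3 * \<Lambda>) * B\<^sup>2 * (real N)\<^sup>2)"
    using dyadic_elimination[OF less_imp_le[OF \<tau>(1)] tm \<tau>(3) \<Lambda>(1) F(1,2) j F(3)] by blast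
  have p: "(2 ^ j - 1) * (8 * x) \<le> 16 * ?A * x" if "x \<ge> 0" for x :: real
    using mult_right_mono[OF conjunct1[OF pow], of "8 * x"] that by simp
  show ?thesis
  proof (intro exI[of _ K] exI[of _ q] conjI allI impI)
    show "\<bar>log_laplace (\<lambda>\<omega>. t * S K \<omega>) - t\<^sup>2 * q / 2\<bar> \<le> 3 * \<eta> * (t\<^sup>2 * q) + 16 * ?A * exp (- 3 * \<Lambda>)"
      if "\<bar>t\<bar> * B \<le> \<tau>" for t
      using K(5)[OF that] p[OF exp_ge_zero] by (meson add_left_mono order_trans)
    show "\<bar>expectation (\<lambda>\<omega>. (S K \<omega>)\<^sup>2) - q\<bar> \<le> 16 * ?A * exp (- 3 * \<Lambda>) * (B\<^sup>2 * (real N)\<^sup>2)"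
      using order_trans[OF K(6)] p[of "exp (- 3 * \<Lambda>) * (B\<^sup>2 * (real N)\<^sup>2)"] by (simp only: mult.assoc) simp
    show "real (card (F - K)) \<le> 10 * gap_const * ?A * (\<tau> * \<Lambda> / \<eta>)" using K(4) pow by linarith
  qed (use K in auto)
qed

text \<open>With \<open>\<eta> = 1 / 2\<close> and
  \<open>\<tau> = 1 / (40 * gap_const * \<Lambda>)\<close> the removed proportion
  \<open>10 * gap_const * \<tau> * \<Lambda> / \<eta>\<close> is exactly one half.\<close>

lemma half_elimination:
  assumes F: "finite F" "F \<subseteq> {1..}" "F \<noteq> {}" "card F \<le> N" and \<Lambda>: "\<Lambda> \<ge> 1" "ln (real N) \<le> \<Lambda>"
  shows "\<exists>K. K \<subseteq> F \<and> 2 * card (F - K) \<le> card F \<and>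
    (\<forall>t. \<bar>t\<bar> * (40 * gap_const * \<Lambda> * B) \<le> 1 \<longrightarrow>
      log_laplace (\<lambda>\<omega>. t * S K \<omega>) \<le> t\<^sup>2 * (2 * V * real (card F) + 64 * B\<^sup>2))"
proof -
  let ?A = "real (card F)"
  have A1: "card F \<ge> 1" using F by (simp add: Suc_leI card_gt_0_iff)
  define \<tau> where "\<tau> = 1 / (40 * gap_const * \<Lambda>)"
  have gL: "gap_const * \<Lambda> \<ge> 1" using mult_mono[OF gap_const_ge_1 \<Lambda>(1)] gap_const_ge_1 by simp
  have \<tau>: "0 < \<tau>" "\<tau> \<le> 1 / 2" using gL by (auto simp: \<tau>_def field_simps)
  obtain K q where K: "K \<subseteq> F" "0 \<le> q" "q \<le> V * ?A"
      "real (card (F - K)) \<le> 10 * gap_const * ?A * (\<tau> * \<Lambda> / (1 / 2))"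
      "\<And>t. \<bar>t\<bar> * B \<le> \<tau> \<Longrightarrow> \<bar>log_laplace (\<lambda>\<omega>. t * S K \<omega>) - t\<^sup>2 * q / 2\<bar>
            \<le> 3 * (1 / 2) * (t\<^sup>2 * q) + 16 * ?A * exp (- 3 * \<Lambda>)"
    using block_elimination[OF F(1,2,4) \<tau> order_refl \<Lambda>] by blast
  have "10 * gap_const * ?A * (\<tau> * \<Lambda> / (1 / 2)) = ?A / 2"
    using gap_const_ge_1 \<Lambda> by (simp add: \<tau>_def field_simps)
  then have c: "2 * card (F - K) \<le> card F" using K(4) by linarith
  have "log_laplace (\<lambda>\<omega>. t * S K \<omega>) \<le> t\<^sup>2 * (2 * V * ?A + 64 * B\<^sup>2)"
    if t: "\<bar>t\<bar> * (40 * gap_const * \<Lambda> * B) \<le> 1" for t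
  \<comment> \<open>The error of the cuts does not vanish with \<open>t\<close>, so alone it has no
    bound of order \<open>t\<^sup>2\<close>. For small \<open>t\<close> the cuts are avoided: all of
    \<open>K\<close> is one admissible block. Otherwise
    \<open>1 / ?A\<^sup>2 \<le> 4 * t\<^sup>2 * B\<^sup>2\<close> absorbs the error, and 16 * 4 =
    64.\<close>
  proof (cases "\<bar>t\<bar> * B * ?A \<le> 1 / 2")
    case True
    have cK: "card K \<le> card F" using K(1) F(1) by (rule card_mono[rotated])
    then have "\<bar>t\<bar> * B * real (card K) \<le> \<bar>t\<bar> * B * ?A" using B_pos by (intro mult_left_mono) auto
    then have "\<bar>t\<bar> * B * real (card K) \<le> 1 / 2" using True by linarith
    from block_log_laplace[OF _ this order_refl] K(1) F(2)
    have "log_laplace (\<lambda>\<omega>. t * S K \<omega>) \<le> 2 * (t\<^sup>2 * expectation (\<lambda>\<omega>. (S K \<omega>)\<^sup>2))"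
      unfolding abs_le_iff by simp
    also have "\<dots> \<le> 2 * (t\<^sup>2 * (V * real (card K)))"
      using S_second_moment_le[of K] K(1) F(1,2) finite_subset by (intro mult_left_mono) auto
    also have "\<dots> \<le> 2 * (t\<^sup>2 * (V * ?A))" using cK V_nonneg by (intro mult_left_mono) auto
    also have "\<dots> \<le> t\<^sup>2 * (2 * V * ?A + 64 * B\<^sup>2)" by (simp add: algebra_simps)
    finally show ?thesis .
  next
    case False
    have "\<bar>t\<bar> * B \<le> \<tau>" using t gL by (simp add: \<tau>_def pos_le_divide_eq ac_simps)
    from K(5)[OF this] have "log_laplace (\<lambda>\<omega>. t * S K \<omega>) \<le> 2 * (t\<^sup>2 * q) + 16 * ?A * exp (- 3 * \<Lambda>)"
      unfolding abs_le_iff by simp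
    also have "2 * (t\<^sup>2 * q) \<le> 2 * (t\<^sup>2 * (V * ?A))" using K(3) by (intro mult_left_mono) auto
    also have "16 * ?A * exp (- 3 * \<Lambda>) \<le> 16 * ?A * (1 / ?A ^ 3)"
      using exp_minus_3_le[OF \<Lambda>(2) _ A1] F(4) by (intro mult_left_mono) auto
    also have "\<dots> = 16 * (1 / ?A\<^sup>2)" using A1 by (simp add: power3_eq_cube power2_eq_square)
    also have "1 / ?A\<^sup>2 \<le> 4 * (t\<^sup>2 * B\<^sup>2)"
    proof -
      have "(1 / 2)\<^sup>2 \<le> (\<bar>t\<bar> * B * ?A)\<^sup>2" using False by (intro power_mono) auto
      also have "(\<bar>t\<bar> * B * ?A)\<^sup>2 = (t\<^sup>2 * B\<^sup>2) * ?A\<^sup>2" by (simp add: power_mult_distrib)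
      finally have "1 \<le> 4 * (t\<^sup>2 * B\<^sup>2) * ?A\<^sup>2" by (simp add: power_divide)
      then show ?thesis using A1 by (simp add: divide_le_eq)
    qed
    finally show ?thesis by (simp add: algebra_simps)
  qed
  then show ?thesis using K(1) c by blast
qed

end

section \<open>Adding Bernstein-type bounds without independence\<close>

context prob_space
begin

text \<open>The combination is optimal for the convexity weight
  \<open>w = \<sigma>\<^sub>1 (1 - c t) / \<sigma> + c\<^sub>1 t\<close> with \<open>\<sigma> = \<sigma>\<^sub>1 + \<sigma>\<^sub>2\<close> and \<open>c = c\<^sub>1 + c\<^sub>2\<close>.\<close>

lemma log_laplace_add:
  assumes Z1: "Z1 \<in> borel_measurable M" "\<And>\<omega>. \<bar>Z1 \<omega>\<bar> \<le> (b1::real)"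
    and Z2: "Z2 \<in> borel_measurable M" "\<And>\<omega>. \<bar>Z2 \<omega>\<bar> \<le> (b2::real)"
    and pos: "\<sigma>1 > 0" "\<sigma>2 > 0" "c1 \<ge> 0" "c2 \<ge> 0"
    and h1: "\<And>t. \<bar>t\<bar> * c1 < 1 \<Longrightarrow> log_laplace (\<lambda>\<omega>. t * Z1 \<omega>) \<le> t\<^sup>2 * \<sigma>1\<^sup>2 / (1 - \<bar>t\<bar> * c1)"
    and h2: "\<And>t. \<bar>t\<bar> * c2 < 1 \<Longrightarrow> log_laplace (\<lambda>\<omega>. t * Z2 \<omega>) \<le> t\<^sup>2 * \<sigma>2\<^sup>2 / (1 - \<bar>t\<bar> * c2)"
    and t: "\<bar>t\<bar> * (c1 + c2) < 1"
  shows "log_laplace (\<lambda>\<omega>. t * (Z1 \<omega> + Z2 \<omega>)) \<le> t\<^sup>2 * (\<sigma>1 + \<sigma>2)\<^sup>2 / (1 - \<bar>t\<bar> * (c1 + c2))"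
proof -
  define d where "d = 1 - \<bar>t\<bar> * (c1 + c2)"
  have d: "d > 0" using t by (simp add: d_def)
  define w where "w = \<sigma>1 / (\<sigma>1 + \<sigma>2) * d + \<bar>t\<bar> * c1"
  define w' where "w' = \<sigma>2 / (\<sigma>1 + \<sigma>2) * d + \<bar>t\<bar> * c2"
  have "w + w' = (\<sigma>1 / (\<sigma>1 + \<sigma>2) + \<sigma>2 / (\<sigma>1 + \<sigma>2)) * d + \<bar>t\<bar> * (c1 + c2)"
    unfolding w_def w'_def by (simp add: algebra_simps)
  also have "\<sigma>1 / (\<sigma>1 + \<sigma>2) + \<sigma>2 / (\<sigma>1 + \<sigma>2) = 1" using pos by (simp add: add_divide_distrib[symmetric])
  finally have ww: "w' = 1 - w" unfolding d_def by simp
  \<comment> \<open>For this weight \<open>1 - \<bar>t / v\<bar> * k\<close> equals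
    \<open>s / (\<sigma>1 + \<sigma>2) * d / v\<close>. Each part then contributes in proportion to
    its own \<open>s\<close>, and the two contributions add up to
    \<open>(\<sigma>1 + \<sigma>2)\<^sup>2\<close>.\<close>
  have part: "v * log_laplace (\<lambda>\<omega>. t / v * Z \<omega>) \<le> t\<^sup>2 * (s * (\<sigma>1 + \<sigma>2)) / d"
    if v: "v = s / (\<sigma>1 + \<sigma>2) * d + \<bar>t\<bar> * k" and s: "s > 0" and k: "k \<ge> 0"
      and h: "\<And>t. \<bar>t\<bar> * k < 1 \<Longrightarrow> log_laplace (\<lambda>\<omega>. t * Z \<omega>) \<le> t\<^sup>2 * s\<^sup>2 / (1 - \<bar>t\<bar> * k)" for v s k Z
  proof -
    have sd: "s / (\<sigma>1 + \<sigma>2) * d > 0" using s pos d by simp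
    have tk: "\<bar>t\<bar> * k \<ge> 0" using k by simp
    have v0: "v > 0" "\<bar>t\<bar> * k < v" using v sd tk by linarith+
    have "\<bar>t / v\<bar> * k < 1" using v0 by (simp add: divide_less_eq)
    from h[OF this] have "v * log_laplace (\<lambda>\<omega>. t / v * Z \<omega>) \<le> v * ((t / v)\<^sup>2 * s\<^sup>2 / (1 - \<bar>t / v\<bar> * k))"
      using v0 by (intro mult_left_mono) auto
    also have "1 - \<bar>t / v\<bar> * k = (s / (\<sigma>1 + \<sigma>2) * d) / v" using v v0 by (simp add: field_simps)
    also have "v * ((t / v)\<^sup>2 * s\<^sup>2 / ((s / (\<sigma>1 + \<sigma>2) * d) / v)) = t\<^sup>2 * (s * (\<sigma>1 + \<sigma>2)) / d"
      using v0 s pos d by (simp add: field_simps power2_eq_square)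
    finally show ?thesis .
  qed
  have w0: "w > 0" "w' > 0" unfolding w_def w'_def using pos d by (auto intro!: add_pos_nonneg)
  have "log_laplace (\<lambda>\<omega>. t * (Z1 \<omega> + Z2 \<omega>)) = log_laplace (\<lambda>\<omega>. w * (t / w * Z1 \<omega>) + (1 - w) * (t / w' * Z2 \<omega>))"
    unfolding ww[symmetric] using w0 by (simp add: algebra_simps)
  also have "\<dots> \<le> w * log_laplace (\<lambda>\<omega>. t / w * Z1 \<omega>) + (1 - w) * log_laplace (\<lambda>\<omega>. t / w' * Z2 \<omega>)"
  proof (rule log_laplace_convex)
    show "\<bar>t / w * Z1 \<omega>\<bar> \<le> \<bar>t / w\<bar> * b1" for \<omega> using Z1(2)[of \<omega>] by (simp only: abs_mult) (intro mult_left_mono, auto)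
    show "\<bar>t / w' * Z2 \<omega>\<bar> \<le> \<bar>t / w'\<bar> * b2" for \<omega> using Z2(2)[of \<omega>] by (simp only: abs_mult) (intro mult_left_mono, auto)
  qed (use Z1 Z2 w0 ww in auto)
  also have "\<dots> \<le> t\<^sup>2 * (\<sigma>1 * (\<sigma>1 + \<sigma>2)) / d + t\<^sup>2 * (\<sigma>2 * (\<sigma>1 + \<sigma>2)) / d"
    unfolding ww[symmetric] using part[OF w_def pos(1,3) h1] part[OF w'_def pos(2,4) h2] by linarith
  also have "\<dots> = t\<^sup>2 * (\<sigma>1 + \<sigma>2)\<^sup>2 / d" by (simp add: add_divide_distrib[symmetric] power2_eq_square algebra_simps)
  finally show ?thesis by (simp add: d_def)
qed

end

context mixing_row
begin

text \<open>Induction on the binary length of \<open>card F\<close>: half elimination handles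
  \<open>K\<close>, the induction hypothesis the remaining half, and the bounds are combined by
  adding standard deviations and reciprocal ranges. The deviations form a geometric series of ratio
  \<open>sqrt 2\<close>, so their sum stays of the order of the largest; the ranges are equal at
  every step and give \<open>i * k\<close>.\<close>

lemma bernstein_dyadic:
  assumes \<Lambda>: "\<Lambda> \<ge> 1" "ln (real N) \<le> \<Lambda>"
  defines "k \<equiv> 40 * gap_const * \<Lambda> * B"
  shows "\<lbrakk>finite F; F \<subseteq> {1..}; card F < 2 ^ i; card F \<le> N; \<bar>t\<bar> * (real i * k) < 1\<rbrakk> \<Longrightarrow>
    log_laplace (\<lambda>\<omega>. t * S F \<omega>) \<le>
      t\<^sup>2 * (4 * sqrt (2 * V) * sqrt 2 ^ i + 8 * B * real (Suc i))\<^sup>2 / (1 - \<bar>t\<bar> * (real i * k))"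
proof (induction i arbitrary: F t)
  case 0
  then have "F = {}" by simp
  then show ?case by (simp add: log_laplace_S_empty)
next
  case (Suc i)
  let ?s = "\<lambda>i. 4 * sqrt (2 * V) * sqrt 2 ^ i + 8 * B * real (Suc i)"
  have k0: "k \<ge> 0" unfolding k_def using gap_const_ge_1 \<Lambda> B_pos by simp
  have den: "1 - \<bar>t\<bar> * (real (Suc i) * k) > 0" using Suc.prems(5) by simp
  show ?case
  proof (cases "F = {}")
    case True
    then show ?thesis using den by (simp add: log_laplace_S_empty)
  next
    case False
    obtain K where K: "K \<subseteq> F" "2 * card (F - K) \<le> card F"
      "\<And>t. \<bar>t\<bar> * k \<le> 1 \<Longrightarrow> log_laplace (\<lambda>\<omega>. t * S K \<omega>) \<le> t\<^sup>2 * (2 * V * real (card F) + 64 * B\<^sup>2)"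
      using half_elimination[OF Suc.prems(1,2) False Suc.prems(4) \<Lambda>] unfolding k_def by blast
    \<comment> \<open>The summand \<open>8 * B\<close> accounts for \<open>64 * B\<^sup>2\<close>
      and keeps the deviation positive even when \<open>V = 0\<close>.\<close>
    define s where "s = sqrt (2 * V) * sqrt 2 ^ Suc i + 8 * B"
    have s0: "s > 0" using V_nonneg B_pos unfolding s_def by (intro add_nonneg_pos) auto
    have s1: "?s i > 0" using V_nonneg B_pos by (intro add_nonneg_pos) auto
    have fin: "finite K" "finite (F - K)" using K(1) Suc.prems(1) finite_subset by auto
    have sub: "K \<subseteq> {1..}" "F - K \<subseteq> {1..}" using K(1) Suc.prems(2) by auto
    have hK: "log_laplace (\<lambda>\<omega>. u * S K \<omega>) \<le> u\<^sup>2 * s\<^sup>2 / (1 - \<bar>u\<bar> * k)" if u: "\<bar>u\<bar> * k < 1" for u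
    proof -
      have uk: "\<bar>u\<bar> * k \<ge> 0" using k0 by simp
      have "real (card F) \<le> 2 ^ Suc i" using Suc.prems(3)
        by (metis less_imp_le of_nat_le_iff of_nat_numeral of_nat_power)
      then have "2 * V * real (card F) \<le> 2 * V * 2 ^ Suc i" using V_nonneg by (intro mult_left_mono) auto
      also have "\<dots> = (sqrt (2 * V) * sqrt 2 ^ Suc i)\<^sup>2"
        using V_nonneg by (simp add: power_mult_distrib sqrt_2_power_square)
      finally have "2 * V * real (card F) \<le> (sqrt (2 * V) * sqrt 2 ^ Suc i)\<^sup>2" .
      moreover have "0 \<le> 2 * (sqrt (2 * V) * sqrt 2 ^ Suc i) * (8 * B)"
        using V_nonneg B_pos by (intro mult_nonneg_nonneg) auto
      moreover have "(8 * B)\<^sup>2 = 64 * B\<^sup>2" by (simp add: power_mult_distrib)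
      ultimately have "2 * V * real (card F) + 64 * B\<^sup>2 \<le> s\<^sup>2"
        unfolding s_def power2_sum by linarith
      then have "u\<^sup>2 * (2 * V * real (card F) + 64 * B\<^sup>2) \<le> u\<^sup>2 * s\<^sup>2" by (intro mult_left_mono) auto
      also have "\<dots> \<le> u\<^sup>2 * s\<^sup>2 / (1 - \<bar>u\<bar> * k)"
      proof -
        have "u\<^sup>2 * s\<^sup>2 * (1 - \<bar>u\<bar> * k) \<le> u\<^sup>2 * s\<^sup>2 * 1" using uk by (intro mult_left_mono) auto
        then show ?thesis using u by (simp add: pos_le_divide_eq)
      qed
      finally show ?thesis using K(3)[of u] u by simp
    qed
    have cR: "card (F - K) < 2 ^ i" "card (F - K) \<le> N" using K(2) Suc.prems(3,4) by auto
    have ck: "\<bar>t\<bar> * (k + real i * k) < 1" using Suc.prems(5) by (simp add: algebra_simps)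
    have "log_laplace (\<lambda>\<omega>. t * (S K \<omega> + S (F - K) \<omega>)) \<le> t\<^sup>2 * (s + ?s i)\<^sup>2 / (1 - \<bar>t\<bar> * (k + real i * k))"
      by (rule log_laplace_add[OF S_measurable[OF sub(1)] S_bound S_measurable[OF sub(2)] S_bound s0 s1 k0 _ hK _ ck])
        (use k0 Suc.IH[OF fin(2) sub(2) cR] in auto)
    also have "(\<lambda>\<omega>. t * (S K \<omega> + S (F - K) \<omega>)) = (\<lambda>\<omega>. t * S F \<omega>)"
    proof -
      have "S F \<omega> = S K \<omega> + S (F - K) \<omega>" for \<omega>
        using S_union[OF fin] K(1) by (metis Diff_disjoint Diff_partition)
      then show ?thesis by simp
    qed
    also have "t\<^sup>2 * (s + ?s i)\<^sup>2 / (1 - \<bar>t\<bar> * (k + real i * k)) \<le> t\<^sup>2 * (?s (Suc i))\<^sup>2 / (1 - \<bar>t\<bar> * (k + real i * k))"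
    proof (intro divide_right_mono mult_left_mono power_mono)
      \<comment> \<open>The factor 4 is reproduced by the induction because
        \<open>sqrt 2 + 4 \<le> 4 * sqrt 2\<close>, that is,
        \<open>sqrt 2 \<ge> 4 / 3\<close>.\<close>
      have "sqrt 2 \<ge> (4 / 3 :: real)" by (rule real_le_rsqrt) (simp add: power2_eq_square)
      then have "(sqrt 2 + 4) * sqrt 2 ^ i \<le> 4 * sqrt 2 * sqrt 2 ^ i" by (intro mult_right_mono) auto
      then have "sqrt (2 * V) * ((sqrt 2 + 4) * sqrt 2 ^ i) \<le> sqrt (2 * V) * (4 * sqrt 2 * sqrt 2 ^ i)"
        using V_nonneg by (intro mult_left_mono) auto
      then show "s + ?s i \<le> ?s (Suc i)" unfolding s_def by (simp add: algebra_simps)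
    qed (use s0 s1 ck in auto)
    also have "k + real i * k = real (Suc i) * k" by (simp add: algebra_simps)
    finally show ?thesis .
  qed
qed

text \<open>At most \<open>3 * \<Lambda>\<close> halvings occur, each using
  \<open>40 * gap_const * \<Lambda> * B\<close>: this is where the square of the logarithm arises.
  Doubling their product to 240 keeps the denominator above 1/2. The constants 256 and 4096 come
  from \<open>(x + y)\<^sup>2 \<le> 2 * x\<^sup>2 + 2 * y\<^sup>2\<close>,
  \<open>2 ^ i \<le> 2 * card F\<close> and \<open>i + 1 \<le> 4 * \<Lambda>\<close>.\<close>

lemma bernstein:
  assumes F: "finite F" "F \<subseteq> {1..}" "card F \<le> N" and \<Lambda>: "\<Lambda> \<ge> 1" "ln (real N) \<le> \<Lambda>"
    and t: "\<bar>t\<bar> * (240 * gap_const * \<Lambda>\<^sup>2 * B) \<le> 1"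
  shows "log_laplace (\<lambda>\<omega>. t * S F \<omega>) \<le> t\<^sup>2 * (256 * V * real (card F) + 4096 * B\<^sup>2 * \<Lambda>\<^sup>2)"
proof (cases "F = {}")
  case True
  then show ?thesis by (simp add: log_laplace_S_empty)
next
  case False
  let ?A = "real (card F)"
  have A1: "card F > 0" using F False by (simp add: card_gt_0_iff)
  define i where "i = (LEAST i. card F < 2 ^ i)"
  have "card F < 2 ^ card F" by (rule less_exp)
  then have i: "card F < 2 ^ i" unfolding i_def by (rule LeastI)
  then obtain l where l: "i = Suc l" using A1 by (cases i) auto
  have "\<not> card F < 2 ^ l" using not_less_Least[of l "\<lambda>i. card F < 2 ^ i"] l unfolding i_def by auto
  then have lA: "2 ^ l \<le> ?A" by (metis not_less of_nat_le_iff of_nat_numeral of_nat_power)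
  have iL: "real i \<le> 3 * \<Lambda>" unfolding l
    by (rule exponent_le_of_power_two_le[OF _ \<Lambda>(2,1)]) (use lA F(3) in linarith)
  have "\<bar>t\<bar> * (real i * (40 * gap_const * \<Lambda> * B)) \<le> \<bar>t\<bar> * ((3 * \<Lambda>) * (40 * gap_const * \<Lambda> * B))"
    using iL gap_const_ge_1 \<Lambda> B_pos by (intro mult_left_mono mult_right_mono) auto
  also have "\<dots> = \<bar>t\<bar> * (240 * gap_const * \<Lambda>\<^sup>2 * B) / 2" by (simp add: power2_eq_square)
  finally have half: "\<bar>t\<bar> * (real i * (40 * gap_const * \<Lambda> * B)) \<le> 1 / 2" using t by linarith
  let ?s = "4 * sqrt (2 * V) * sqrt 2 ^ i + 8 * B * real (Suc i)"
  have "log_laplace (\<lambda>\<omega>. t * S F \<omega>) \<le> t\<^sup>2 * ?s\<^sup>2 / (1 - \<bar>t\<bar> * (real i * (40 * gap_const * \<Lambda> * B)))"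
    by (rule bernstein_dyadic[OF \<Lambda> F(1,2) i F(3)]) (use half in linarith)
  also have "\<dots> \<le> t\<^sup>2 * ?s\<^sup>2 / (1 / 2)" using half by (intro divide_left_mono) auto
  also have "\<dots> = t\<^sup>2 * (2 * ?s\<^sup>2)" by simp
  also have "\<dots> \<le> t\<^sup>2 * (256 * V * ?A + 4096 * B\<^sup>2 * \<Lambda>\<^sup>2)"
  proof (rule mult_left_mono)
    have "(x + y)\<^sup>2 \<le> 2 * x\<^sup>2 + 2 * y\<^sup>2" for x y :: real
      using sum_squares_bound[of x y] by (simp add: power2_sum)
    then have "?s\<^sup>2 \<le> 2 * (4 * sqrt (2 * V) * sqrt 2 ^ i)\<^sup>2 + 2 * (8 * B * real (Suc i))\<^sup>2" .
    also have "(4 * sqrt (2 * V) * sqrt 2 ^ i)\<^sup>2 = 32 * V * 2 ^ i"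
      using V_nonneg by (simp add: power_mult_distrib sqrt_2_power_square)
    also have "(2::real) ^ i \<le> 2 * ?A" using lA l by simp
    also have "(8 * B * real (Suc i))\<^sup>2 \<le> (8 * B * (4 * \<Lambda>))\<^sup>2"
      using iL \<Lambda> B_pos by (intro power_mono mult_left_mono) auto
    finally have "?s\<^sup>2 \<le> 2 * (32 * V * (2 * ?A)) + 2 * (8 * B * (4 * \<Lambda>))\<^sup>2"
      using V_nonneg by (simp add: mult_left_mono)
    then show "2 * ?s\<^sup>2 \<le> 256 * V * ?A + 4096 * B\<^sup>2 * \<Lambda>\<^sup>2" by (simp add: power_mult_distrib)
  qed simp
  finally show ?thesis .
qed

end

section \<open>Asymptotics of a row\<close>

lemma square_add_le_weighted:
  fixes x y w :: real
  assumes "0 < w" "w < 1"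
  shows "(x + y)\<^sup>2 \<le> x\<^sup>2 / w + y\<^sup>2 / (1 - w)"
proof -
  have "0 \<le> ((1 - w) * x - w * y)\<^sup>2" by simp
  then have "(x + y)\<^sup>2 * (w * (1 - w)) \<le> x\<^sup>2 * (1 - w) + y\<^sup>2 * w"
    by (simp add: power2_eq_square algebra_simps)
  then have "(x + y)\<^sup>2 \<le> (x\<^sup>2 * (1 - w) + y\<^sup>2 * w) / (w * (1 - w))"
    using assms by (simp add: pos_le_divide_eq)
  also have "\<dots> = x\<^sup>2 / w + y\<^sup>2 / (1 - w)" using assms by (simp add: field_simps)
  finally show ?thesis .
qed

context mixing_row
begin

text \<open>Both signs are needed: the row is the sum of kept and removed parts, and the kept part
  is the row minus the removed one. A weight \<open>w\<close> near 1 leaves the main term almost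
  unchanged.\<close>

lemma second_moment_add_le:
  assumes "0 < w" "w < 1" "F \<subseteq> {1..}" "G \<subseteq> {1..}" "H \<subseteq> {1..}"
    and S: "\<And>\<omega>. S H \<omega> = S F \<omega> + S G \<omega> \<or> S H \<omega> = S F \<omega> - S G \<omega>"
  shows "expectation (\<lambda>\<omega>. (S H \<omega>)\<^sup>2) \<le>
    expectation (\<lambda>\<omega>. (S F \<omega>)\<^sup>2) / w + expectation (\<lambda>\<omega>. (S G \<omega>)\<^sup>2) / (1 - w)"
proof -
  note i = integrable_S_square[OF assms(3)] integrable_S_square[OF assms(4)] integrable_S_square[OF assms(5)]
  have "expectation (\<lambda>\<omega>. (S H \<omega>)\<^sup>2) \<le> expectation (\<lambda>\<omega>. (S F \<omega>)\<^sup>2 / w + (S G \<omega>)\<^sup>2 / (1 - w))"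
  proof (rule integral_mono)
    fix \<omega>
    show "(S H \<omega>)\<^sup>2 \<le> (S F \<omega>)\<^sup>2 / w + (S G \<omega>)\<^sup>2 / (1 - w)"
      using S[of \<omega>] square_add_le_weighted[OF assms(1,2), of "S F \<omega>" "S G \<omega>"]
        square_add_le_weighted[OF assms(1,2), of "S F \<omega>" "- S G \<omega>"] by auto
  qed (use i in auto)
  also have "\<dots> = expectation (\<lambda>\<omega>. (S F \<omega>)\<^sup>2) / w + expectation (\<lambda>\<omega>. (S G \<omega>)\<^sup>2) / (1 - w)"
    using i by simp
  finally show ?thesis .
qed

text \<open>The kept part \<open>K\<close> has the Gaussian expansion, the removed part
  \<open>R\<close> a Bernstein bound. Convexity with weight \<open>1 - \<theta>\<close> on
  \<open>K\<close> gives the upper estimate; the lower one results from writing a multiple of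
  \<open>S K\<close> as a convex combination of the row and a multiple of \<open>S R\<close>. In
  \<open>err\<close>, 32 stems from the cuts, the term with \<open>V\<close> from the size of
  \<open>R\<close>, and \<open>x\<^sup>2\<close> from the terms in \<open>B\<^sup>2\<close>.\<close>

lemma log_laplace_row:
  assumes n: "n \<ge> 3" and t: "t \<noteq> 0" and \<theta>: "0 < \<theta>" "\<theta> \<le> 1 / 2"
  defines "x \<equiv> \<bar>t\<bar> * B * (ln (real n))\<^sup>2"
    and "s \<equiv> expectation (\<lambda>\<omega>. (S {1..n} \<omega>)\<^sup>2)"
    and "L \<equiv> log_laplace (\<lambda>\<omega>. t * S {1..n} \<omega>)"
  defines "err \<equiv> 32 + (31200 * V * gap_const * (t\<^sup>2 * real n) * (x / \<theta>) + 4160 * x\<^sup>2) / \<theta>"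
  assumes x: "240 * gap_const * x \<le> \<theta>"
  shows "(1 - \<theta>) ^ 3 * (t\<^sup>2 * s / 2) - err \<le> L \<and> L \<le> (1 + \<theta>) / (1 - \<theta>)\<^sup>2 * (t\<^sup>2 * s / 2) + err"
proof -
  define \<Lambda> where "\<Lambda> = ln (real n)"
  have \<Lambda>: "\<Lambda> \<ge> 1"
  proof -
    have "exp 1 \<le> real n" using exp_le n by linarith
    then show ?thesis unfolding \<Lambda>_def using n by (simp add: ln_ge_iff)
  qed
  define w where "w = 1 - \<theta>"
  have w: "0 < w" "w < 1" "1 / 2 \<le> w" "1 - w = \<theta>" using \<theta> by (auto simp: w_def)
  \<comment> \<open>Convexity evaluates \<open>K\<close> at \<open>t / w\<close> with
    \<open>w \<ge> 1 / 2\<close>, whence the factor 2.\<close>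
  define \<tau> where "\<tau> = 2 * \<bar>t\<bar> * B"
  \<comment> \<open>Makes the error \<open>3 * \<eta> * (u\<^sup>2 * q)\<close> of the blocks equal
    to \<open>\<theta>\<close> times the main term \<open>u\<^sup>2 * q / 2\<close>.\<close>
  define \<eta> where "\<eta> = \<theta> / 6"
  have xL: "\<bar>t\<bar> * B * \<Lambda>\<^sup>2 = x" by (simp add: x_def \<Lambda>_def)
  have x0: "x \<ge> 0" unfolding x_def using B_pos by simp
  have gx: "240 * x \<le> 240 * gap_const * x" using gap_const_ge_1 x0 by (simp add: mult_le_cancel_right1)
  have L2: "\<Lambda> \<le> \<Lambda>\<^sup>2" "1 \<le> \<Lambda>\<^sup>2" using \<Lambda> one_le_power[OF \<Lambda>, of 2] by (auto simp: self_le_power)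
  have tB: "\<bar>t\<bar> * B * 1 \<le> x" "\<bar>t\<bar> * B * \<Lambda> \<le> x" unfolding xL[symmetric]
    using L2 B_pos by (intro mult_left_mono; simp)+
  have tauL: "\<tau> * \<Lambda> \<le> 2 * x" using tB(2) by (simp add: \<tau>_def)
  have tau: "0 < \<tau>" "\<tau> \<le> \<eta>" "\<eta> \<le> 1 / 2"
    using t B_pos tB(1) gx x \<theta> by (auto simp: \<tau>_def \<eta>_def)
  have F: "finite {1..n}" "{1..n} \<subseteq> {1..}" "card {1..n} \<le> n" by auto
  obtain K q where K: "K \<subseteq> {1..n}" "0 \<le> q" "q \<le> V * real (card {1..n})"
      "real (card ({1..n} - K)) \<le> 10 * gap_const * real (card {1..n}) * (\<tau> * \<Lambda> / \<eta>)"
      "\<And>t. \<bar>t\<bar> * B \<le> \<tau> \<Longrightarrow> \<bar>log_laplace (\<lambda>\<omega>. t * S K \<omega>) - t\<^sup>2 * q / 2\<bar>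
            \<le> 3 * \<eta> * (t\<^sup>2 * q) + 16 * real (card {1..n}) * exp (- 3 * \<Lambda>)"
      "\<bar>expectation (\<lambda>\<omega>. (S K \<omega>)\<^sup>2) - q\<bar> \<le> 16 * real (card {1..n}) * exp (- 3 * \<Lambda>) * (B\<^sup>2 * (real n)\<^sup>2)"
    using block_elimination[OF F tau \<Lambda>, unfolded \<Lambda>_def, OF order_refl] unfolding \<Lambda>_def by blast
  define R where "R = {1..n} - K"
  define r where "r = 120 * gap_const * real n * (x / \<theta>)"
  define DR where "DR = 256 * V * r + 4096 * B\<^sup>2 * \<Lambda>\<^sup>2"
  have r0: "r \<ge> 0" unfolding r_def using gap_const_ge_1 x0 \<theta> by simp
  have sub: "K \<subseteq> {1..}" "R \<subseteq> {1..}" "finite K" "finite R" "R \<subseteq> {1..n}"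
    using K(1) finite_subset[OF K(1)] unfolding R_def by auto
  have cR: "real (card R) \<le> r"
  proof -
    have "real (card R) \<le> 10 * gap_const * real n * (\<tau> * \<Lambda> / \<eta>)" using K(4) by (simp add: R_def)
    also have "\<dots> \<le> 10 * gap_const * real n * (2 * x / \<eta>)"
      using tauL gap_const_ge_1 tau by (intro mult_left_mono divide_right_mono) auto
    also have "\<dots> = r" unfolding r_def \<eta>_def by simp
    finally show ?thesis .
  qed
  have SS: "S {1..n} \<omega> = S K \<omega> + S R \<omega>" for \<omega>
    using S_union[OF sub(3,4)] K(1) unfolding R_def by (metis Diff_disjoint Diff_partition)
  have n3: "16 * real n * exp (- 3 * \<Lambda>) \<le> 16 / (real n)\<^sup>2"
  proof -
    have "exp (- 3 * \<Lambda>) \<le> 1 / real n ^ 3" using n by (intro exp_minus_3_le[of n]) (auto simp: \<Lambda>_def)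
    then have "16 * real n * exp (- 3 * \<Lambda>) \<le> 16 * real n * (1 / real n ^ 3)" by (intro mult_left_mono) auto
    also have "\<dots> = 16 / (real n)\<^sup>2" using n by (simp add: power3_eq_cube power2_eq_square)
    finally show ?thesis .
  qed
  have e16: "16 * real n * exp (- 3 * \<Lambda>) \<le> 16"
  proof -
    have "1 \<le> (real n)\<^sup>2" using n by simp
    then have "16 / (real n)\<^sup>2 \<le> 16" using n by (simp add: divide_le_eq)
    then show ?thesis using n3 by linarith
  qed
  have lapK: "\<bar>log_laplace (\<lambda>\<omega>. u * S K \<omega>) - u\<^sup>2 * q / 2\<bar> \<le> \<theta> / 2 * (u\<^sup>2 * q) + 16" if u: "\<bar>u\<bar> \<le> 2 * \<bar>t\<bar>" for u
  proof -
    have "\<bar>u\<bar> * B \<le> \<tau>" unfolding \<tau>_def using u B_pos by (intro mult_right_mono) auto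
    from K(5)[OF this] e16 show ?thesis by (simp add: \<eta>_def)
  qed
  have lapK': "log_laplace (\<lambda>\<omega>. u * S K \<omega>) \<le> u\<^sup>2 * q / 2 * (1 + \<theta>) + 16"
    "u\<^sup>2 * q / 2 * (1 - \<theta>) - 16 \<le> log_laplace (\<lambda>\<omega>. u * S K \<omega>)" if u: "\<bar>u\<bar> \<le> 2 * \<bar>t\<bar>" for u
  proof -
    have "l \<le> y / 2 * (1 + \<theta>) + 16 \<and> y / 2 * (1 - \<theta>) - 16 \<le> l"
      if "\<bar>l - y / 2\<bar> \<le> \<theta> / 2 * y + 16" for l y :: real
      using that unfolding abs_le_iff by (simp add: field_simps)
    from this[OF lapK[OF u]] show "log_laplace (\<lambda>\<omega>. u * S K \<omega>) \<le> u\<^sup>2 * q / 2 * (1 + \<theta>) + 16"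
      "u\<^sup>2 * q / 2 * (1 - \<theta>) - 16 \<le> log_laplace (\<lambda>\<omega>. u * S K \<omega>)"
      by auto
  qed
  \<comment> \<open>The hypothesis on \<open>x\<close> is what puts the parameter
    \<open>t / \<theta>\<close> within the range of the Bernstein bound.\<close>
  have lapR: "log_laplace (\<lambda>\<omega>. u * S R \<omega>) \<le> u\<^sup>2 * DR" if u: "\<bar>u\<bar> \<le> \<bar>t\<bar> / \<theta>" for u
  proof -
    have "\<bar>u\<bar> * (240 * gap_const * \<Lambda>\<^sup>2 * B) \<le> \<bar>t\<bar> / \<theta> * (240 * gap_const * \<Lambda>\<^sup>2 * B)"
      using u gap_const_ge_1 B_pos by (intro mult_right_mono) auto
    also have "\<dots> = 240 * gap_const * x / \<theta>" unfolding xL[symmetric] by simp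
    also have "\<dots> \<le> 1" using x \<theta> by simp
    finally have h: "\<bar>u\<bar> * (240 * gap_const * \<Lambda>\<^sup>2 * B) \<le> 1" .
    have "card R \<le> n" using card_mono[OF F(1) sub(5)] by simp
    from bernstein[OF sub(4,2) this \<Lambda> _ h]
    have "log_laplace (\<lambda>\<omega>. u * S R \<omega>) \<le> u\<^sup>2 * (256 * V * real (card R) + 4096 * B\<^sup>2 * \<Lambda>\<^sup>2)"
      unfolding \<Lambda>_def by simp
    also have "\<dots> \<le> u\<^sup>2 * DR" unfolding DR_def using cR V_nonneg by (intro mult_left_mono add_right_mono) auto
    finally show ?thesis .
  qed
  have DR0: "DR \<ge> 0" unfolding DR_def using V_nonneg r0 by simp
  have VR: "expectation (\<lambda>\<omega>. (S R \<omega>)\<^sup>2) \<le> V * r"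
    using S_second_moment_le[OF sub(4,2)] mult_left_mono[OF cR V_nonneg] by linarith
  have qK: "\<bar>expectation (\<lambda>\<omega>. (S K \<omega>)\<^sup>2) - q\<bar> \<le> 16 * B\<^sup>2"
  proof -
    have "16 * real n * exp (- 3 * \<Lambda>) * (B\<^sup>2 * (real n)\<^sup>2) \<le> 16 / (real n)\<^sup>2 * (B\<^sup>2 * (real n)\<^sup>2)"
      using n3 by (intro mult_right_mono) auto
    also have "\<dots> = 16 * B\<^sup>2" using n by simp
    finally show ?thesis using K(6) by simp
  qed
  \<comment> \<open>The error in exchanging \<open>q\<close> for the second moment \<open>s\<close>
    of the row: the share of \<open>R\<close>, divided by its weight \<open>\<theta>\<close>, and
    the covariances across the cuts.\<close>
  define eq where "eq = V * r / \<theta> + 16 * B\<^sup>2"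
  have eq0: "eq \<ge> 0" unfolding eq_def using V_nonneg r0 \<theta> by simp
  have VRt: "expectation (\<lambda>\<omega>. (S R \<omega>)\<^sup>2) / (1 - w) \<le> V * r / \<theta>" unfolding w(4) using VR \<theta> by (intro divide_right_mono) auto
  have q1: "q \<le> s / w + eq"
  proof -
    have "expectation (\<lambda>\<omega>. (S K \<omega>)\<^sup>2) \<le> s / w + expectation (\<lambda>\<omega>. (S R \<omega>)\<^sup>2) / (1 - w)"
      unfolding s_def by (rule second_moment_add_le[OF w(1,2) F(2) sub(2,1)]) (simp add: SS del: One_nat_def)
    then show ?thesis using VRt qK unfolding eq_def by linarith
  qed
  have q2: "w * s \<le> q + eq"
  proof -
    have "s \<le> expectation (\<lambda>\<omega>. (S K \<omega>)\<^sup>2) / w + expectation (\<lambda>\<omega>. (S R \<omega>)\<^sup>2) / (1 - w)"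
      unfolding s_def by (rule second_moment_add_le[OF w(1,2) sub(1,2) F(2)]) (simp add: SS del: One_nat_def)
    also have "\<dots> \<le> expectation (\<lambda>\<omega>. (S K \<omega>)\<^sup>2) / w + V * r / \<theta>" using VRt by simp
    finally have "w * s \<le> w * (expectation (\<lambda>\<omega>. (S K \<omega>)\<^sup>2) / w + V * r / \<theta>)"
      using w by (intro mult_left_mono) auto
    also have "\<dots> = expectation (\<lambda>\<omega>. (S K \<omega>)\<^sup>2) + w * (V * r / \<theta>)" using w by (simp add: distrib_left)
    also have "w * (V * r / \<theta>) \<le> 1 * (V * r / \<theta>)" using w V_nonneg r0 \<theta> by (intro mult_right_mono) auto
    finally show ?thesis using qK unfolding eq_def by linarith
  qed
  have errb: "32 + t\<^sup>2 * (2 * eq + DR / \<theta>) \<le> err"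
  proof -
    have "eq \<le> (V * r + 16 * (B\<^sup>2 * \<Lambda>\<^sup>2)) / \<theta>"
    proof -
      have "16 * B\<^sup>2 * \<theta> \<le> 16 * B\<^sup>2 * 1" using \<theta> by (intro mult_left_mono) auto
      also have "\<dots> \<le> 16 * B\<^sup>2 * \<Lambda>\<^sup>2" using L2 by (intro mult_left_mono) auto
      finally show ?thesis unfolding eq_def using \<theta> by (simp add: field_simps)
    qed
    then have "2 * eq + DR / \<theta> \<le> 2 * ((V * r + 16 * (B\<^sup>2 * \<Lambda>\<^sup>2)) / \<theta>) + DR / \<theta>"
      by linarith
    also have "\<dots> = (2 * (V * r + 16 * (B\<^sup>2 * \<Lambda>\<^sup>2)) + DR) / \<theta>" by (simp only: add_divide_distrib[of _ DR] times_divide_eq_right)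
    also have "\<dots> \<le> (260 * V * r + 4160 * (B\<^sup>2 * \<Lambda>\<^sup>2)) / \<theta>"
      unfolding DR_def using V_nonneg r0 \<theta> by (intro divide_right_mono) auto
    finally have "t\<^sup>2 * (2 * eq + DR / \<theta>) \<le> t\<^sup>2 * ((260 * V * r + 4160 * (B\<^sup>2 * \<Lambda>\<^sup>2)) / \<theta>)"
      by (intro mult_left_mono) auto
    also have "\<dots> = (260 * V * (t\<^sup>2 * r) + 4160 * (t\<^sup>2 * B\<^sup>2 * \<Lambda>\<^sup>2)) / \<theta>"
      by (simp add: algebra_simps)
    also have "260 * V * (t\<^sup>2 * r) = 31200 * V * gap_const * (t\<^sup>2 * real n) * (x / \<theta>)"
      unfolding r_def by simp
    also have "t\<^sup>2 * B\<^sup>2 * \<Lambda>\<^sup>2 = (\<bar>t\<bar> * B * \<Lambda>)\<^sup>2" by (simp add: power_mult_distrib)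
    also have "(31200 * V * gap_const * (t\<^sup>2 * real n) * (x / \<theta>) + 4160 * (\<bar>t\<bar> * B * \<Lambda>)\<^sup>2) / \<theta>
      \<le> (31200 * V * gap_const * (t\<^sup>2 * real n) * (x / \<theta>) + 4160 * x\<^sup>2) / \<theta>"
      using tB(2) B_pos \<Lambda> \<theta> by (intro divide_right_mono add_left_mono mult_left_mono power_mono) auto
    finally show ?thesis unfolding err_def by simp
  qed
  have "L \<le> w * log_laplace (\<lambda>\<omega>. t / w * S K \<omega>) + (1 - w) * log_laplace (\<lambda>\<omega>. t / \<theta> * S R \<omega>)"
  proof -
    have e: "(\<lambda>\<omega>. t * S {1..n} \<omega>) = (\<lambda>\<omega>. w * (t / w * S K \<omega>) + (1 - w) * (t / \<theta> * S R \<omega>))"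
      using w \<theta> by (simp add: SS distrib_left del: One_nat_def)
    show ?thesis unfolding L_def e
      by (rule log_laplace_convex[OF mult_S_measurable[OF sub(1)] mult_S_bound mult_S_measurable[OF sub(2)] mult_S_bound])
        (use w in auto)
  qed
  moreover have "w * log_laplace (\<lambda>\<omega>. t / w * S K \<omega>) \<le> w * ((t / w)\<^sup>2 * q / 2 * (1 + \<theta>) + 16)"
  proof -
    have "\<bar>t / w\<bar> \<le> 2 * \<bar>t\<bar>"
    proof -
      have "\<bar>t\<bar> * 1 \<le> \<bar>t\<bar> * (2 * w)" using w by (intro mult_left_mono) auto
      then show ?thesis using w by (simp add: abs_divide divide_le_eq)
    qed
    from lapK'(1)[OF this] show ?thesis using w by (intro mult_left_mono) auto
  qed
  moreover have "w * ((t / w)\<^sup>2 * q / 2 * (1 + \<theta>) + 16) = t\<^sup>2 * q * ((1 + \<theta>) / (2 * w)) + w * 16"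
    using w by (simp add: field_simps power2_eq_square)
  moreover have "(1 - w) * log_laplace (\<lambda>\<omega>. t / \<theta> * S R \<omega>) \<le> t\<^sup>2 * (DR / \<theta>)"
  proof -
    have "(1 - w) * log_laplace (\<lambda>\<omega>. t / \<theta> * S R \<omega>) \<le> \<theta> * ((t / \<theta>)\<^sup>2 * DR)"
      unfolding w(4) using \<theta> by (intro mult_left_mono lapR) (auto simp: abs_divide)
    also have "\<dots> = t\<^sup>2 * (DR / \<theta>)" using \<theta> by (simp add: field_simps power2_eq_square)
    finally show ?thesis .
  qed
  moreover have "t\<^sup>2 * q * ((1 + \<theta>) / (2 * w)) \<le> (1 + \<theta>) / (1 - \<theta>)\<^sup>2 * (t\<^sup>2 * s / 2) + t\<^sup>2 * (2 * eq)"
  proof -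
    have c2: "(1 + \<theta>) / (2 * w) \<le> 2" "(1 + \<theta>) / (2 * w) \<ge> 0" using w \<theta> by (auto simp: divide_le_eq)
    have "t\<^sup>2 * q * ((1 + \<theta>) / (2 * w)) \<le> t\<^sup>2 * (s / w + eq) * ((1 + \<theta>) / (2 * w))"
      using q1 c2 by (intro mult_right_mono mult_left_mono) auto
    also have "\<dots> = (1 + \<theta>) / (1 - \<theta>)\<^sup>2 * (t\<^sup>2 * s / 2) + t\<^sup>2 * eq * ((1 + \<theta>) / (2 * w))"
      unfolding w_def[symmetric] using w by (simp add: field_simps power2_eq_square)
    also have "t\<^sup>2 * eq * ((1 + \<theta>) / (2 * w)) \<le> t\<^sup>2 * eq * 2" using c2 eq0 by (intro mult_left_mono) auto
    finally show ?thesis by simp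
  qed
  moreover have "t\<^sup>2 * (2 * eq + DR / \<theta>) = t\<^sup>2 * (2 * eq) + t\<^sup>2 * (DR / \<theta>)" by (simp add: distrib_left)
  ultimately have upper: "L \<le> (1 + \<theta>) / (1 - \<theta>)\<^sup>2 * (t\<^sup>2 * s / 2) + err" using errb w by linarith
  \<comment> \<open>Convexity in the reverse direction: the row appears inside the combination with
    weight \<open>w\<close>, so the inequality bounds \<open>L\<close> from below.\<close>
  have "log_laplace (\<lambda>\<omega>. w * t * S K \<omega>) \<le> w * L + (1 - w) * log_laplace (\<lambda>\<omega>. (- (w * t / \<theta>)) * S R \<omega>)"
  proof -
    have e: "(\<lambda>\<omega>. w * t * S K \<omega>) = (\<lambda>\<omega>. w * (t * S {1..n} \<omega>) + (1 - w) * ((- (w * t / \<theta>)) * S R \<omega>))"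
      unfolding w(4) SS distrib_left using \<theta> by (simp add: mult.assoc)
    show ?thesis unfolding L_def e
      by (rule log_laplace_convex[OF mult_S_measurable[OF F(2)] mult_S_bound mult_S_measurable[OF sub(2)] mult_S_bound])
        (use w in auto)
  qed
  moreover have "(1 - w) * log_laplace (\<lambda>\<omega>. (- (w * t / \<theta>)) * S R \<omega>) \<le> w * (t\<^sup>2 * (DR / \<theta>))"
  proof -
    have wt: "\<bar>w * t\<bar> \<le> \<bar>t\<bar>" using w mult_right_mono[of w 1 "\<bar>t\<bar>"] by (simp add: abs_mult)
    have "(1 - w) * log_laplace (\<lambda>\<omega>. (- (w * t / \<theta>)) * S R \<omega>) \<le> \<theta> * ((- (w * t / \<theta>))\<^sup>2 * DR)"
      unfolding w(4) using \<theta> wt by (intro mult_left_mono lapR) (auto simp: abs_divide divide_right_mono)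
    also have "\<dots> = w * (w * (t\<^sup>2 * (DR / \<theta>)))" using \<theta> by (simp add: field_simps power2_eq_square)
    also have "\<dots> \<le> w * (1 * (t\<^sup>2 * (DR / \<theta>)))" using w DR0 \<theta> by (intro mult_left_mono mult_right_mono) auto
    finally show ?thesis by simp
  qed
  moreover have "log_laplace (\<lambda>\<omega>. w * t * S K \<omega>) \<ge> (w * t)\<^sup>2 * q / 2 * (1 - \<theta>) - 16"
  proof -
    have "\<bar>w * t\<bar> \<le> 2 * \<bar>t\<bar>" using w mult_right_mono[of w 2 "\<bar>t\<bar>"] by (simp add: abs_mult)
    then show ?thesis by (rule lapK'(2))
  qed
  moreover have "(w * t)\<^sup>2 * q / 2 * (1 - \<theta>) = w * (t\<^sup>2 * (w\<^sup>2 * q / 2))"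
    unfolding w_def[symmetric] by (simp add: power2_eq_square)
  ultimately have "w * (t\<^sup>2 * (w\<^sup>2 * q / 2)) - 16 - w * (t\<^sup>2 * (DR / \<theta>)) \<le> w * L" by linarith
  moreover have "16 \<le> w * 32" using w by simp
  ultimately have "w * (t\<^sup>2 * (w\<^sup>2 * q / 2) - 32 - t\<^sup>2 * (DR / \<theta>)) \<le> w * L" by (simp add: right_diff_distrib)
  then have l1: "t\<^sup>2 * (w\<^sup>2 * q / 2) - 32 - t\<^sup>2 * (DR / \<theta>) \<le> L" using w by simp
  have "w\<^sup>2 * (w * s) / 2 \<le> w\<^sup>2 * (q + eq) / 2" using q2 by (intro divide_right_mono mult_left_mono) auto
  also have "\<dots> = w\<^sup>2 * q / 2 + w\<^sup>2 * eq / 2" by (simp add: field_simps)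
  also have "w\<^sup>2 * eq / 2 \<le> 1 * eq / 2" using w eq0 by (intro divide_right_mono mult_right_mono) (auto simp: power_le_one)
  finally have "w\<^sup>2 * (w * s) / 2 \<le> w\<^sup>2 * q / 2 + 2 * eq" using eq0 by simp
  then have "t\<^sup>2 * (w\<^sup>2 * (w * s) / 2) \<le> t\<^sup>2 * (w\<^sup>2 * q / 2 + 2 * eq)" by (rule mult_left_mono) simp
  then have "w ^ 3 * (t\<^sup>2 * s / 2) \<le> t\<^sup>2 * (w\<^sup>2 * q / 2) + t\<^sup>2 * (2 * eq)"
    by (simp add: distrib_left power2_eq_square power3_eq_cube ac_simps)
  moreover have "t\<^sup>2 * (2 * eq + DR / \<theta>) = t\<^sup>2 * (2 * eq) + t\<^sup>2 * (DR / \<theta>)" by (simp add: distrib_left)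
  ultimately have "w ^ 3 * (t\<^sup>2 * s / 2) - err \<le> L" using l1 errb by linarith
  then show ?thesis using upper by (simp add: w_def)
qed

end

section \<open>From the array to truncated rows\<close>

lemma (in prob_space) mixing_defect_le_1:
  "\<bar>prob (A \<inter> B) - prob A * prob B\<bar> \<le> 1"
proof -
  have "0 \<le> prob A * prob B" "prob A * prob B \<le> 1"
    using mult_mono[of "prob A" 1 "prob B" 1] by auto
  moreover have "0 \<le> prob (A \<inter> B)" "prob (A \<inter> B) \<le> 1" by auto
  ultimately show ?thesis by linarith
qed

lemma (in prob_space) strong_mixing_coeff_upper:
  assumes "A \<in> \<A>" "B \<in> \<B>"
  shows "\<bar>prob (A \<inter> B) - prob A * prob B\<bar> \<le> strong_mixing_coeff M \<A> \<B>"
  unfolding strong_mixing_coeff_def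
  using assms mixing_defect_le_1
  by (intro cSUP_upper2[where x="(A, B)"]) (auto intro!: bdd_aboveI2[where M=1] simp: split_beta)

lemma (in prob_space) strong_mixing_coeff_le_1:
  assumes "\<A> \<noteq> {}" "\<B> \<noteq> {}"
  shows "strong_mixing_coeff M \<A> \<B> \<le> 1"
  unfolding strong_mixing_coeff_def
  using assms mixing_defect_le_1 by (intro cSUP_least) auto

lemma gen_sigma_nonempty: "gen_sigma P Y I \<noteq> {}"
  using sigma_sets.Empty[of "space P"] unfolding gen_sigma_def by blast

text \<open>The suprema are real-valued, so a member is below its supremum only once the family is
  known to be bounded; the bound 1 is carried through each level of nesting.\<close>

lemma (in prob_space) strong_mixing_coeff_le_mixing_array:
  assumes "n \<ge> 1" "j \<ge> 1"
  shows "strong_mixing_coeff M (gen_sigma M (\<lambda>i. X i n) {1..j}) (gen_sigma M (\<lambda>i. X i n) {k + j..})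
    \<le> mixing_array M X k"
proof -
  have le1: "strong_mixing_coeff M (gen_sigma M Y {1..j}) (gen_sigma M Y {k + j..}) \<le> 1" for Y j
    using gen_sigma_nonempty by (rule strong_mixing_coeff_le_1) (rule gen_sigma_nonempty)
  have "strong_mixing_coeff M (gen_sigma M (\<lambda>i. X i n) {1..j}) (gen_sigma M (\<lambda>i. X i n) {k + j..})
    \<le> mixing_seq M (\<lambda>i. X i n) k"
    unfolding mixing_seq_def using assms(2) le1
    by (intro cSUP_upper) (auto intro!: bdd_aboveI2[where M=1])
  moreover have "mixing_seq M Y k \<le> 1" for Y
    unfolding mixing_seq_def using le1 by (intro cSUP_least) auto
  then have "mixing_seq M (\<lambda>i. X i n) k \<le> mixing_array M X k"
    unfolding mixing_array_def using assms(1)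
    by (intro cSUP_upper) (auto intro!: bdd_aboveI2[where M=1])
  ultimately show ?thesis by (rule order_trans)
qed

text \<open>Lets truncated variables inherit the mixing rate: they generate smaller
  sigma-algebras.\<close>

lemma gen_sigma_comp_subset:
  fixes f :: "real \<Rightarrow> real"
  assumes f: "f \<in> borel_measurable borel"
  shows "gen_sigma P (\<lambda>i \<omega>. f (Y i \<omega>)) I \<subseteq> gen_sigma P Y I"
  unfolding gen_sigma_def
proof (rule sigma_sets_mono, safe)
  fix i B assume i: "i \<in> I" and B: "B \<in> sets (borel :: real measure)"
  have "(\<lambda>\<omega>. f (Y i \<omega>)) -` B \<inter> space P = Y i -` (f -` B) \<inter> space P" by auto
  moreover have "f -` B \<in> sets borel" using measurable_sets[OF f B] by simp
  ultimately show "(\<lambda>\<omega>. f (Y i \<omega>)) -` B \<inter> space P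
      \<in> sigma_sets (space P) (\<Union>i\<in>I. {Y i -` B \<inter> space P | B. B \<in> sets borel})"
    using i by (intro sigma_sets.Basic) auto
qed

text \<open>The smallest index is split off: its square and its products with all later indices are
  covered by \<open>v\<close>, whatever indices are missing.\<close>

lemma (in prob_space) second_moment_sum_le:
  fixes Y :: "nat \<Rightarrow> 'a \<Rightarrow> real"
  assumes Y: "\<And>i. i \<ge> 1 \<Longrightarrow> Y i \<in> borel_measurable M" "\<And>i \<omega>. \<bar>Y i \<omega>\<bar> \<le> B"
    and v: "\<And>i A. \<lbrakk>i \<ge> 1; finite A; \<forall>j\<in>A. i < j\<rbrakk> \<Longrightarrow>
      expectation (\<lambda>\<omega>. (Y i \<omega>)\<^sup>2) + 2 * (\<Sum>j\<in>A. \<bar>expectation (\<lambda>\<omega>. Y i \<omega> * Y j \<omega>)\<bar>) \<le> v"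
    and F: "finite F" "F \<subseteq> {1..}"
  shows "expectation (\<lambda>\<omega>. (\<Sum>i\<in>F. Y i \<omega>)\<^sup>2) \<le> v * real (card F)"
  using F
proof (induction F rule: finite_linorder_min_induct)
  case (insert i A)
  have i: "i \<ge> 1" "A \<subseteq> {1..}" "i \<notin> A" using insert by auto
  have ij: "integrable M (\<lambda>\<omega>. Y j \<omega> * Y k \<omega>)" if "j \<ge> 1" "k \<ge> 1" for j k
  proof (rule integrable_const_bound[where B="B * B"])
    have "B \<ge> 0" using Y(2)[of 0 undefined] by linarith
    then show "AE \<omega> in M. norm (Y j \<omega> * Y k \<omega>) \<le> B * B" using Y(2) by (auto simp: abs_mult intro!: mult_mono)
    show "(\<lambda>\<omega>. Y j \<omega> * Y k \<omega>) \<in> borel_measurable M" using Y(1) that by measurable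
  qed
  let ?S = "\<lambda>\<omega>. \<Sum>j\<in>A. Y j \<omega>"
  have sq: "(Y i \<omega> + ?S \<omega>)\<^sup>2 = (Y i \<omega>)\<^sup>2 + 2 * (\<Sum>j\<in>A. Y i \<omega> * Y j \<omega>) + (?S \<omega>)\<^sup>2" for \<omega>
    by (simp add: power2_sum sum_distrib_left mult.assoc)
  have ii: "integrable M (\<lambda>\<omega>. (Y i \<omega>)\<^sup>2)" using ij[OF i(1,1)] by (simp add: power2_eq_square)
  have iA: "integrable M (\<lambda>\<omega>. \<Sum>j\<in>A. Y i \<omega> * Y j \<omega>)" using i by (intro Bochner_Integration.integrable_sum ij) auto
  have iS: "integrable M (\<lambda>\<omega>. (?S \<omega>)\<^sup>2)"
    unfolding power2_eq_square sum_product using i by (intro Bochner_Integration.integrable_sum ij) auto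
  have "expectation (\<lambda>\<omega>. (\<Sum>j\<in>insert i A. Y j \<omega>)\<^sup>2) = expectation (\<lambda>\<omega>. (Y i \<omega> + ?S \<omega>)\<^sup>2)"
    using insert.hyps(1) i(3) by simp
  also have "\<dots> = expectation (\<lambda>\<omega>. (Y i \<omega>)\<^sup>2) + 2 * expectation (\<lambda>\<omega>. \<Sum>j\<in>A. Y i \<omega> * Y j \<omega>) + expectation (\<lambda>\<omega>. (?S \<omega>)\<^sup>2)"
    unfolding sq using ii iA iS by simp
  also have "expectation (\<lambda>\<omega>. \<Sum>j\<in>A. Y i \<omega> * Y j \<omega>) = (\<Sum>j\<in>A. expectation (\<lambda>\<omega>. Y i \<omega> * Y j \<omega>))"
    using i by (intro Bochner_Integration.integral_sum ij) auto
  also have "\<dots> \<le> (\<Sum>j\<in>A. \<bar>expectation (\<lambda>\<omega>. Y i \<omega> * Y j \<omega>)\<bar>)" by (intro sum_mono) auto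
  also have "expectation (\<lambda>\<omega>. (?S \<omega>)\<^sup>2) \<le> v * real (card A)" using insert.IH i(2) by simp
  finally have "expectation (\<lambda>\<omega>. (\<Sum>j\<in>insert i A. Y j \<omega>)\<^sup>2) \<le>
    expectation (\<lambda>\<omega>. (Y i \<omega>)\<^sup>2) + 2 * (\<Sum>j\<in>A. \<bar>expectation (\<lambda>\<omega>. Y i \<omega> * Y j \<omega>)\<bar>) + v * real (card A)" by simp
  also have "\<dots> \<le> v + v * real (card A)" using v[OF i(1) insert.hyps(1,2)] by simp
  also have "\<dots> = v * real (card (insert i A))" using insert.hyps(1) i(3) by (simp add: algebra_simps)
  finally show ?case .
qed simp

text \<open>Separates the two limits: errors containing \<open>1 / \<theta>\<close> are sent to 0 in
  \<open>n\<close> at fixed \<open>\<theta>\<close>, and only then do the two envelopes close up on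
  \<open>y\<close>.\<close>

lemma tendsto_of_relative_error:
  fixes f :: "nat \<Rightarrow> real"
  assumes "\<And>\<theta>. \<lbrakk>0 < \<theta>; \<theta> \<le> 1 / 2\<rbrakk> \<Longrightarrow>
    \<forall>\<^sub>F n in sequentially. (1 - \<theta>) ^ 3 * y - \<theta> \<le> f n \<and> f n \<le> (1 + \<theta>) / (1 - \<theta>)\<^sup>2 * y + \<theta>"
  shows "f \<longlonglongrightarrow> y"
proof (rule tendstoI)
  fix e :: real assume e: "e > 0"
  have "((\<lambda>\<theta>::real. (1 - \<theta>) ^ 3 * y - \<theta>) \<longlongrightarrow> y) (at_right 0)" by (auto intro!: tendsto_eq_intros)
  moreover have "((\<lambda>\<theta>::real. (1 + \<theta>) / (1 - \<theta>)\<^sup>2 * y + \<theta>) \<longlongrightarrow> y) (at_right 0)" by (auto intro!: tendsto_eq_intros)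
  ultimately have "\<forall>\<^sub>F \<theta> in at_right 0. dist ((1 - \<theta>) ^ 3 * y - \<theta>) y < e \<and>
      dist ((1 + \<theta>) / (1 - \<theta>)\<^sup>2 * y + \<theta>) y < e \<and> \<theta> \<in> {0<..<1 / 2}"
    using e by (intro eventually_conj tendstoD eventually_at_right_real) auto
  then obtain \<theta> where "dist ((1 - \<theta>) ^ 3 * y - \<theta>) y < e \<and>
      dist ((1 + \<theta>) / (1 - \<theta>)\<^sup>2 * y + \<theta>) y < e \<and> \<theta> \<in> {0<..<1 / 2}"
    using eventually_happens trivial_limit_at_right_real by blast
  then have \<theta>: "dist ((1 - \<theta>) ^ 3 * y - \<theta>) y < e"
      "dist ((1 + \<theta>) / (1 - \<theta>)\<^sup>2 * y + \<theta>) y < e" "0 < \<theta>" "\<theta> \<le> 1 / 2"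
    by auto
  show "\<forall>\<^sub>F n in sequentially. dist (f n) y < e"
    using assms[OF \<theta>(3,4)] by eventually_elim (use \<theta>(1,2) in \<open>auto simp: dist_real_def\<close>)
qed

text \<open>Truncation makes an essential bound hold at every point, while changing the variables on
  null sets only.\<close>

definition clamp_real :: "real \<Rightarrow> real \<Rightarrow> real" where "clamp_real b x = max (- b) (min b x)"

lemma clamp_real_measurable: "clamp_real b \<in> borel_measurable borel"
  unfolding clamp_real_def[abs_def] by measurable

text \<open>Moments and covariances are insensitive to changes on null sets. The generated
  sigma-algebras are not, but they can only shrink, since the new variables are functions of the old
  ones.\<close>

lemma mixing_row_clamp:
  fixes P :: "'a measure" and X :: "nat \<Rightarrow> nat \<Rightarrow> 'a \<Rightarrow> real"
  assumes P: "prob_space P"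
    and meas: "\<And>j. j \<ge> 1 \<Longrightarrow> X j n \<in> borel_measurable P"
    and b: "b > 0" and n: "n \<ge> 1"
    and bound: "\<And>j. j \<ge> 1 \<Longrightarrow> esssup P (\<lambda>\<omega>. ereal \<bar>X j n \<omega>\<bar>) \<le> ereal b"
    and centered: "\<And>j. j \<ge> 1 \<Longrightarrow> prob_space.expectation P (X j n) = 0"
    and c: "c > 0"
    and mixing: "\<And>k. k \<ge> 1 \<Longrightarrow> mixing_array P X k \<le> exp (- 2 * c * real k)"
    and cov: "cov_bound P X < \<infinity>"
  shows "\<And>j. j \<ge> 1 \<Longrightarrow> AE \<omega> in P. clamp_real b (X j n \<omega>) = X j n \<omega>"
    and "mixing_row P (\<lambda>j \<omega>. clamp_real b (X j n \<omega>)) b c (enn2real (cov_bound P X))"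
proof -
  interpret prob_space P by fact
  define Y where "Y j \<omega> = clamp_real b (X j n \<omega>)" for j \<omega>
  show AE: "AE \<omega> in P. clamp_real b (X j n \<omega>) = X j n \<omega>" if "j \<ge> 1" for j
    using esssup_AE[of "\<lambda>\<omega>. ereal \<bar>X j n \<omega>\<bar>" P]
  proof eventually_elim
    case (elim \<omega>)
    then have "ereal \<bar>X j n \<omega>\<bar> \<le> ereal b" using bound[OF that] by (rule order_trans)
    then show ?case by (auto simp: clamp_real_def)
  qed
  have Ym: "Y j \<in> borel_measurable P" if "j \<ge> 1" for j
    unfolding Y_def using meas[OF that] clamp_real_measurable by (rule measurable_compose)
  have Yb: "\<bar>Y j \<omega>\<bar> \<le> b" for j \<omega> unfolding Y_def clamp_real_def using b by auto
  have EY: "expectation (Y j) = 0" if "j \<ge> 1" for j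
  proof -
    have "expectation (Y j) = expectation (X j n)"
      by (rule integral_cong_AE) (use AE[OF that] Ym[OF that] meas[OF that] in \<open>auto simp: Y_def\<close>)
    then show ?thesis using centered[OF that] by simp
  qed
  have YX: "expectation (\<lambda>\<omega>. Y i \<omega> * Y j \<omega>) = covariance P (X i n) (X j n)" if "i \<ge> 1" "j \<ge> 1" for i j
  proof -
    have "expectation (\<lambda>\<omega>. Y i \<omega> * Y j \<omega>) = expectation (\<lambda>\<omega>. X i n \<omega> * X j n \<omega>)"
    proof (rule integral_cong_AE)
      show "AE \<omega> in P. Y i \<omega> * Y j \<omega> = X i n \<omega> * X j n \<omega>"
        using AE[OF that(1)] AE[OF that(2)] by eventually_elim (simp add: Y_def)
    qed (use Ym meas that in measurable)
    then show ?thesis using centered that by (simp add: covariance_def)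
  qed
  have Yv: "expectation (\<lambda>\<omega>. (Y i \<omega>)\<^sup>2) = variance (X i n)" if "i \<ge> 1" for i
    using YX[OF that that] by (simp add: power2_eq_square covariance_def)
  have v: "expectation (\<lambda>\<omega>. (Y i \<omega>)\<^sup>2) + 2 * (\<Sum>j\<in>A. \<bar>expectation (\<lambda>\<omega>. Y i \<omega> * Y j \<omega>)\<bar>) \<le> enn2real (cov_bound P X)"
    if i: "i \<ge> 1" and A: "finite A" "\<forall>j\<in>A. i < j" for i A
  proof -
    let ?c = "\<lambda>j. \<bar>covariance P (X i n) (X j n)\<bar>"
    \<comment> \<open>Undoes the reindexing \<open>j = i + 1 + m\<close> in
      \<open>cov_bound\<close>; the truncated subtraction is injective because all of
      \<open>A\<close> lies above \<open>i\<close>.\<close>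
    have inj: "inj_on (\<lambda>j. j - Suc i) A"
    proof (rule inj_onI)
      fix x y assume "x \<in> A" "y \<in> A" "x - Suc i = y - Suc i"
      moreover have "i < x" "i < y" using A(2) calculation by auto
      ultimately show "x = y" by simp
    qed
    have "(\<Sum>j\<in>A. ennreal (?c j)) = (\<Sum>m\<in>(\<lambda>j. j - Suc i) ` A. ennreal (?c (i + 1 + m)))"
      unfolding sum.reindex[OF inj] by (rule sum.cong) (use A(2) in auto)
    also have "\<dots> \<le> (\<Sum>m. ennreal (?c (i + 1 + m)))"
      using A(1) by (intro sum_le_suminf summableI) auto
    finally have s: "(\<Sum>j\<in>A. ennreal (?c j)) \<le> (\<Sum>m. ennreal (?c (i + 1 + m)))" .
    have "ennreal (expectation (\<lambda>\<omega>. (Y i \<omega>)\<^sup>2) + 2 * (\<Sum>j\<in>A. \<bar>expectation (\<lambda>\<omega>. Y i \<omega> * Y j \<omega>)\<bar>))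
      = ennreal (variance (X i n) + 2 * (\<Sum>j\<in>A. ?c j))"
    proof -
      have "(\<Sum>j\<in>A. \<bar>expectation (\<lambda>\<omega>. Y i \<omega> * Y j \<omega>)\<bar>) = (\<Sum>j\<in>A. ?c j)"
        by (rule sum.cong[OF refl], subst YX) (use i A(2) in auto)
      then show ?thesis using Yv[OF i] by simp
    qed
    also have "\<dots> = ennreal (variance (X i n)) + 2 * (\<Sum>j\<in>A. ennreal (?c j))"
      by (simp add: ennreal_plus ennreal_mult sum_nonneg sum_ennreal)
    also have "\<dots> \<le> ennreal (variance (X i n)) + 2 * (\<Sum>m. ennreal (?c (i + 1 + m)))"
      using s by (intro add_left_mono mult_left_mono) auto
    also have "\<dots> \<le> cov_bound P X"
      unfolding cov_bound_def using n i by (intro SUP_upper2[of n] SUP_upper2[of i]) auto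
    also have "\<dots> = ennreal (enn2real (cov_bound P X))" using cov by simp
    finally show ?thesis by (subst (asm) ennreal_le_iff) auto
  qed
  have "mixing_row P Y b c (enn2real (cov_bound P X))"
  proof
    fix j k A A' assume jk: "1 \<le> j" "1 \<le> k" and A: "A \<in> gen_sigma P Y {1..j}" "A' \<in> gen_sigma P Y {k + j..}"
    have "gen_sigma P Y I \<subseteq> gen_sigma P (\<lambda>i. X i n) I" for I
      unfolding Y_def[abs_def] by (rule gen_sigma_comp_subset[OF clamp_real_measurable])
    then have "\<bar>prob (A \<inter> A') - prob A * prob A'\<bar> \<le>
      strong_mixing_coeff P (gen_sigma P (\<lambda>i. X i n) {1..j}) (gen_sigma P (\<lambda>i. X i n) {k + j..})"
      using A by (intro strong_mixing_coeff_upper) auto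
    also have "\<dots> \<le> mixing_array P X k" by (rule strong_mixing_coeff_le_mixing_array[OF n jk(1)])
    also have "\<dots> \<le> exp (- 2 * c * real k)" by (rule mixing[OF jk(2)])
    finally show "\<bar>prob (A \<inter> A') - prob A * prob A'\<bar> \<le> exp (- 2 * c * real k)" .
  next
    fix F :: "nat set" assume "finite F" "F \<subseteq> {1..}"
    then show "expectation (\<lambda>\<omega>. (\<Sum>i\<in>F. Y i \<omega>)\<^sup>2) \<le> enn2real (cov_bound P X) * real (card F)"
      using second_moment_sum_le[OF Ym Yb v] by blast
  qed (use Ym Yb b c EY in auto)
  then show "mixing_row P (\<lambda>j \<omega>. clamp_real b (X j n \<omega>)) b c (enn2real (cov_bound P X))"
    unfolding Y_def[abs_def] .
qed

section \<open>Moderate deviations for the array\<close>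

theorem theorem6:
  fixes P :: "'a measure"
    and X :: "nat \<Rightarrow> nat \<Rightarrow> 'a \<Rightarrow> real"
    and M a \<sigma> :: "nat \<Rightarrow> real"
    and c :: real
  assumes "prob_space P"
    and meas: "\<And>j n. j \<ge> 1 \<Longrightarrow> n \<ge> 1 \<Longrightarrow> X j n \<in> borel_measurable P"
    and M_pos: "\<And>n. n \<ge> 1 \<Longrightarrow> M n > 0"
    and bound: "\<And>j n. j \<ge> 1 \<Longrightarrow> n \<ge> 1 \<Longrightarrow> esssup P (\<lambda>\<omega>. ereal \<bar>X j n \<omega>\<bar>) \<le> ereal (M n)"
    and centered: "\<And>j n. j \<ge> 1 \<Longrightarrow> n \<ge> 1 \<Longrightarrow> prob_space.expectation P (X j n) = 0"
    and c_pos: "c > 0"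
    and mixing: "\<And>k. k \<ge> 1 \<Longrightarrow> mixing_array P X k \<le> exp (- 2 * c * real k)"
    and cov_finite: "cov_bound P X < \<infinity>"
    and sigma: "\<And>n. \<sigma> n = sqrt (prob_space.variance P (partial_sum X n))"
    and var_lower: "liminf (\<lambda>n. ereal ((\<sigma> n)\<^sup>2 / real n)) > 0"
    and a_pos: "\<And>n. n \<ge> 1 \<Longrightarrow> a n > 0"
    and a_lim: "a \<longlonglongrightarrow> 0"
    and a_growth: "filterlim (\<lambda>n. real n * a n / ((M n)\<^sup>2 * (ln (real n)) ^ 4)) at_top sequentially"
  shows "good_rate_function (\<lambda>t. ereal (t\<^sup>2 / 2)) \<and>
    moderate_deviations P (\<lambda>n \<omega>. partial_sum X n \<omega> / \<sigma> n) a (\<lambda>t. ereal (t\<^sup>2 / 2))"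
proof
  show "good_rate_function (\<lambda>t. ereal (t\<^sup>2 / 2))" by (rule good_rate_function_half_square)
  interpret prob_space P by fact
  define V where "V = enn2real (cov_bound P X)"
  define Y where "Y n = (\<lambda>j \<omega>. clamp_real (M n) (X j n \<omega>))" for n
  define S where "S n \<omega> = (\<Sum>i\<in>{1..n}. Y n i \<omega>)" for n \<omega>
  define gc where "gc = 3 / (2 * c) + 1"
  have row: "mixing_row P (Y n) (M n) c V" if "n \<ge> 1" for n
    unfolding Y_def V_def
    by (rule mixing_row_clamp(2)) (use assms that in auto)
  have AE_S: "AE \<omega> in P. partial_sum X n \<omega> = S n \<omega>" if n: "n \<ge> 1" for n
  proof -
    have "AE \<omega> in P. \<forall>i\<in>{1..n}. clamp_real (M n) (X i n \<omega>) = X i n \<omega>"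
    proof (rule AE_finite_allI)
      fix i assume "i \<in> {1..n}"
      then show "AE \<omega> in P. clamp_real (M n) (X i n \<omega>) = X i n \<omega>"
        by (intro mixing_row_clamp(1)[where c=c]) (use assms n in auto)
    qed simp
    then show ?thesis by eventually_elim (simp add: partial_sum_def S_def Y_def)
  qed
  have pm: "partial_sum X n \<in> borel_measurable P" if "n \<ge> 1" for n
    unfolding partial_sum_def[abs_def] using meas that by (intro borel_measurable_sum) auto
  have Sm: "S n \<in> borel_measurable P" and Sb: "\<bar>S n \<omega>\<bar> \<le> M n * real n"
    and E0: "expectation (S n) = 0" if n: "n \<ge> 1" for n \<omega>
  proof -
    interpret r: mixing_row P "Y n" "M n" c V by (rule row[OF n])
    have e: "S n = r.S {1..n}" by (simp add: S_def r.S_def fun_eq_iff)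
    show "S n \<in> borel_measurable P" unfolding e by (rule r.S_measurable) auto
    show "\<bar>S n \<omega>\<bar> \<le> M n * real n" using r.S_bound[of "{1..n}" \<omega>] by (simp add: e)
    show "expectation (S n) = 0" unfolding e by (rule r.expectation_S) auto
  qed
  have AE_comp: "expectation (\<lambda>\<omega>. f (partial_sum X n \<omega>)) = expectation (\<lambda>\<omega>. f (S n \<omega>))"
    if "n \<ge> 1" "f \<in> borel_measurable borel" for n and f :: "real \<Rightarrow> real"
  proof (rule integral_cong_AE)
    show "AE \<omega> in P. f (partial_sum X n \<omega>) = f (S n \<omega>)" using AE_S[OF that(1)] by eventually_elim simp
  qed (use pm[OF that(1)] Sm[OF that(1)] that(2) in measurable)
  have \<sigma>2: "(\<sigma> n)\<^sup>2 = expectation (\<lambda>\<omega>. (S n \<omega>)\<^sup>2)" if n: "n \<ge> 1" for n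
  proof -
    have "expectation (partial_sum X n) = 0" using AE_comp[OF n, of "\<lambda>x. x"] E0[OF n] by simp
    then have "variance (partial_sum X n) = expectation (\<lambda>\<omega>. (S n \<omega>)\<^sup>2)"
      using AE_comp[OF n, of "\<lambda>x. x\<^sup>2"] by simp
    then show ?thesis unfolding sigma by simp
  qed
  \<comment> \<open>From some index on the variance exceeds \<open>d * n\<close>, hence
    \<open>\<sigma> n\<close> is nonzero. At earlier indices division by zero yields 0, which does
    no harm to measurability and integrability.\<close>
  obtain d where d: "0 < ereal d" "ereal d < liminf (\<lambda>n. ereal ((\<sigma> n)\<^sup>2 / real n))"
    using ereal_dense2[OF var_lower] by auto
  then have d0: "d > 0" by simp
  have ev\<sigma>: "\<forall>\<^sub>F n in sequentially. d < (\<sigma> n)\<^sup>2 / real n" using less_LiminfD[OF d(2)] by simp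
  let ?G = "\<lambda>n. real n * a n / ((M n)\<^sup>2 * (ln (real n)) ^ 4)"
  show "moderate_deviations P (\<lambda>n \<omega>. partial_sum X n \<omega> / \<sigma> n) a (\<lambda>t. ereal (t\<^sup>2 / 2))"
  proof (rule gaussian_moderate_deviations[OF _ _ a_pos a_lim])
    show "prob_space P" by fact
    show "(\<lambda>\<omega>. partial_sum X n \<omega> / \<sigma> n) \<in> borel_measurable P" if "n \<ge> 1" for n
      using pm[OF that] by measurable
    show "integrable P (\<lambda>\<omega>. exp (s * (partial_sum X n \<omega> / \<sigma> n)))" if n: "n \<ge> 1" for s n
    proof -
      have "\<bar>s / \<sigma> n * S n \<omega>\<bar> \<le> \<bar>s / \<sigma> n\<bar> * (M n * real n)" for \<omega>
        unfolding abs_mult using Sb[OF n] by (intro mult_left_mono) auto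
      then have i: "integrable P (\<lambda>\<omega>. exp (s / \<sigma> n * S n \<omega>))"
        using Sm[OF n] by (intro integrable_exp_bounded) auto
      have m: "(\<lambda>\<omega>. exp (s * (partial_sum X n \<omega> / \<sigma> n))) \<in> borel_measurable P"
        using pm[OF n] by measurable
      have "AE \<omega> in P. exp (s / \<sigma> n * S n \<omega>) = exp (s * (partial_sum X n \<omega> / \<sigma> n))"
        using AE_S[OF n] by eventually_elim simp
      with i m show ?thesis by (rule integrable_cong_AE_imp)
    qed
    fix s :: real
    define t where "t n = s / (\<sigma> n * sqrt (a n))" for n
    define f where "f n = a n * ln (expectation (\<lambda>\<omega>. exp (s * (partial_sum X n \<omega> / \<sigma> n) / sqrt (a n))))" for n
    show "f \<longlonglongrightarrow> s\<^sup>2 / 2"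
    proof (cases "s = 0")
      case True
      then show ?thesis unfolding f_def by (simp add: prob_space)
    next
      case False
      define x where "x n = \<bar>t n\<bar> * M n * (ln (real n))\<^sup>2" for n
      \<comment> \<open>Squaring \<open>x\<close> produces the fourth power of the logarithm; with
        the linear lower bound on the variance, a constant times the inverse of the diverging
        quotient remains.\<close>
      have evx: "\<forall>\<^sub>F n in sequentially. (x n)\<^sup>2 \<le> s\<^sup>2 / d * inverse (?G n)"
        using ev\<sigma> eventually_ge_at_top[of 3]
      proof eventually_elim
        case (elim n)
        then have an: "a n > 0" and Mn: "M n > 0" using a_pos M_pos by auto
        have ln: "ln (real n) > 0" using elim by simp
        have dn: "0 < d * real n" using d0 elim by simp
        have sd: "d * real n \<le> (\<sigma> n)\<^sup>2" using elim by (simp add: pos_less_divide_eq)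
        have "(x n)\<^sup>2 = s\<^sup>2 * ((M n)\<^sup>2 * (ln (real n)) ^ 4) / ((\<sigma> n)\<^sup>2 * a n)"
          unfolding x_def t_def using an by (simp add: power_mult_distrib power_divide power_mult[symmetric])
        also have "\<dots> \<le> s\<^sup>2 * ((M n)\<^sup>2 * (ln (real n)) ^ 4) / ((d * real n) * a n)"
          using sd less_le_trans[OF dn sd] d0 elim(2) an ln
          by (intro divide_left_mono mult_right_mono mult_pos_pos) auto
        also have "\<dots> = s\<^sup>2 / d * inverse (?G n)" by (simp add: field_simps)
        finally show ?case .
      qed
      have "(\<lambda>n. s\<^sup>2 / d * inverse (?G n)) \<longlonglongrightarrow> s\<^sup>2 / d * 0"
        by (intro tendsto_mult tendsto_const tendsto_inverse_0_at_top a_growth)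
      then have "(\<lambda>n. (x n)\<^sup>2) \<longlonglongrightarrow> 0"
        by (intro tendsto_sandwich[OF _ evx tendsto_const]) auto
      then have "(\<lambda>n. sqrt ((x n)\<^sup>2)) \<longlonglongrightarrow> sqrt 0" by (rule tendsto_real_sqrt)
      then have x0: "x \<longlonglongrightarrow> 0" by (simp add: tendsto_rabs_zero_iff)
      show ?thesis
      proof (rule tendsto_of_relative_error)
        fix \<theta> :: real assume \<theta>: "0 < \<theta>" "\<theta> \<le> 1 / 2"
        \<comment> \<open>Dominates \<open>a n\<close> times the error of the row estimate, with
          \<open>a n * t\<^sup>2 * n\<close> replaced by its bound \<open>s\<^sup>2 / d\<close>; the
          terms vanish through \<open>a n\<close>, \<open>x n\<close> and both of them.\<close>
        define e where "e n = 32 * a n + (31200 * V * gc * (s\<^sup>2 / d) * (x n / \<theta>) + 4160 * (a n * (x n)\<^sup>2)) / \<theta>" for n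
        have "e \<longlonglongrightarrow> 32 * 0 + (31200 * V * gc * (s\<^sup>2 / d) * (0 / \<theta>) + 4160 * (0 * 0\<^sup>2)) / \<theta>"
          unfolding e_def using \<theta> by (intro tendsto_intros a_lim x0) auto
        then have e: "\<forall>\<^sub>F n in sequentially. e n < \<theta>" using \<theta> by (intro order_tendstoD(2)) auto
        have "(\<lambda>n. 240 * gc * x n) \<longlonglongrightarrow> 240 * gc * 0" by (intro tendsto_intros x0)
        then have gx: "\<forall>\<^sub>F n in sequentially. 240 * gc * x n < \<theta>" using \<theta> by (intro order_tendstoD(2)) auto
        show "\<forall>\<^sub>F n in sequentially. (1 - \<theta>) ^ 3 * (s\<^sup>2 / 2) - \<theta> \<le> f n \<and>
          f n \<le> (1 + \<theta>) / (1 - \<theta>)\<^sup>2 * (s\<^sup>2 / 2) + \<theta>"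
          using ev\<sigma> eventually_ge_at_top[of 3] e gx
        proof eventually_elim
          case (elim n)
          then have n1: "n \<ge> 1" by simp
          have an: "a n > 0" using a_pos[OF n1] .
          interpret r: mixing_row P "Y n" "M n" c V by (rule row[OF n1])
          have gc: "r.gap_const = gc" unfolding r.gap_const_def gc_def ..
          have eS: "r.S {1..n} = S n" by (simp add: S_def r.S_def fun_eq_iff)
          have dn: "0 < d * real n" using d0 n1 by simp
          have sd: "d * real n < (\<sigma> n)\<^sup>2" using elim(1) n1 by (simp add: pos_less_divide_eq)
          then have s0: "\<sigma> n \<noteq> 0" using dn by auto
          have t0: "t n \<noteq> 0" unfolding t_def using False s0 an by simp
          define L where "L = log_laplace (\<lambda>\<omega>. t n * S n \<omega>)"
          define err where "err = 32 + (31200 * V * gc * ((t n)\<^sup>2 * real n) * (x n / \<theta>) + 4160 * (x n)\<^sup>2) / \<theta>"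
          have fL: "f n = a n * L"
          proof -
            have "expectation (\<lambda>\<omega>. exp (s * (partial_sum X n \<omega> / \<sigma> n) / sqrt (a n)))
              = expectation (\<lambda>\<omega>. exp (t n * partial_sum X n \<omega>))" by (simp add: t_def)
            also have "\<dots> = expectation (\<lambda>\<omega>. exp (t n * S n \<omega>))"
              by (rule AE_comp[OF n1, of "\<lambda>x. exp (t n * x)"]) measurable
            finally show ?thesis by (simp add: f_def L_def log_laplace_def)
          qed
          have at: "a n * (t n)\<^sup>2 = s\<^sup>2 / (\<sigma> n)\<^sup>2" unfolding t_def using an by (simp add: power_divide power_mult_distrib)
          \<comment> \<open>The normalisation of \<open>t\<close> makes the main term exactly
            \<open>s\<^sup>2 / 2\<close>, whatever the variance is.\<close>
          have ats: "a n * ((t n)\<^sup>2 * (\<sigma> n)\<^sup>2 / 2) = s\<^sup>2 / 2"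
          proof -
            have "a n * ((t n)\<^sup>2 * (\<sigma> n)\<^sup>2 / 2) = (a n * (t n)\<^sup>2) * (\<sigma> n)\<^sup>2 / 2" by simp
            then show ?thesis unfolding at using s0 by simp
          qed
          have b: "(1 - \<theta>) ^ 3 * ((t n)\<^sup>2 * (\<sigma> n)\<^sup>2 / 2) - err \<le> L"
              "L \<le> (1 + \<theta>) / (1 - \<theta>)\<^sup>2 * ((t n)\<^sup>2 * (\<sigma> n)\<^sup>2 / 2) + err"
            using r.log_laplace_row[OF elim(2) t0 \<theta>] elim(4)
            unfolding gc eS \<sigma>2[OF n1, symmetric] x_def[symmetric] err_def L_def by auto
          have atn: "a n * ((t n)\<^sup>2 * real n) \<le> s\<^sup>2 / d"
          proof -
            have "a n * ((t n)\<^sup>2 * real n) = s\<^sup>2 * real n / (\<sigma> n)\<^sup>2" using at by (simp add: mult.assoc[symmetric])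
            also have "\<dots> \<le> s\<^sup>2 * real n / (d * real n)" using sd d0 n1 less_trans[OF dn sd] by (intro divide_left_mono mult_pos_pos) auto
            also have "\<dots> = s\<^sup>2 / d" using n1 by simp
            finally show ?thesis .
          qed
          have xp: "x n \<ge> 0" unfolding x_def using r.B_pos by simp
          have gp: "gc \<ge> 0" using c_pos by (simp add: gc_def)
          have "a n * err = 32 * a n + (31200 * V * gc * (a n * ((t n)\<^sup>2 * real n)) * (x n / \<theta>) + 4160 * (a n * (x n)\<^sup>2)) / \<theta>"
            unfolding err_def by (simp add: algebra_simps add_divide_distrib)
          also have "\<dots> \<le> e n" unfolding e_def
            using atn r.V_nonneg gp xp \<theta>
            by (intro add_left_mono divide_right_mono add_right_mono mult_right_mono mult_left_mono) auto
          finally have ae: "a n * err \<le> \<theta>" using elim(3) by linarith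
          have "a n * ((1 - \<theta>) ^ 3 * ((t n)\<^sup>2 * (\<sigma> n)\<^sup>2 / 2) - err) \<le> a n * L"
              "a n * L \<le> a n * ((1 + \<theta>) / (1 - \<theta>)\<^sup>2 * ((t n)\<^sup>2 * (\<sigma> n)\<^sup>2 / 2) + err)"
            using b an by (intro mult_left_mono; simp)+
          then have "(1 - \<theta>) ^ 3 * (a n * ((t n)\<^sup>2 * (\<sigma> n)\<^sup>2 / 2)) - a n * err \<le> a n * L"
              "a n * L \<le> (1 + \<theta>) / (1 - \<theta>)\<^sup>2 * (a n * ((t n)\<^sup>2 * (\<sigma> n)\<^sup>2 / 2)) + a n * err"
            unfolding right_diff_distrib[of "a n"] distrib_left[of "a n"] by (simp_all only: mult.left_commute[of "a n"])
          then show ?case unfolding ats fL using ae by linarith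
        qed
      qed
    qed
  qed
qed

end
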